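(* Let $a,b>0$, let $\mathcal{E}$ be the ellipse $\frac{x^2}{a}+\frac{y^2}{b}=1$ in the Minkowski plane, let $\gamma\in\mathbb{R}\setminus\{-b,0,a\}$, $\varepsilon=\operatorname{sign}\gamma$, and let $n\ge 3$ be an integer. Write the Taylor expansions around $x=0$ $$\sqrt{\varepsilon(a-x)(b+x)(\gamma-x)}=B_0+B_1x+B_2x^2+\dots,$$ $$\frac{\sqrt{\varepsilon(a-x)(b+x)(\gamma-x)}}{\gamma-x}=C_0+C_1x+C_2x^2+\dots.$$ The billiard trajectories within $\mathcal{E}$ with caustic $\mathcal{C}_\gamma$ are $n$-periodic if and only if: - when $n=2m+1$ is odd ($m\ge1$): $\det\big(C_{i+j}\big)_{1\le i,j\le m}=0$, i.e. $C_2=0$ for $n=3$, $\begin{vmatrix} C_2 & C_3 \\ C_3 & C_4 \end{vmatrix}=0$ for $n=5$, $\begin{vmatrix} C_2 & C_3 & C_4 \\ C_3 & C_4 & C_5 \\ C_4 & C_5 & C_6 \end{vmatrix}=0$ for $n=7$, and so on; - when $n=2m$ is even ($m\ge2$): $\det\big(B_{i+j+1}\big)_{1\le i,j\le m-1}=0$, i.e. $B_3=0$ for $n=4$, $\begin{vmatrix} B_3 & B_4 \\ B_4 & B_5 \end{vmatrix}=0$ for $n=6$, $\begin{vmatrix} B_3 & B_4 & B_5 \\ B_4 & B_5 & B_6 \\ B_5 & B_6 & B_7 \end{vmatrix}=0$ for $n=8$, and so on.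
   Context: The Minkowski plane is $\mathbb{R}^2$ with the scalar product $\langle X,Y\rangle=X_1Y_1-X_2Y_2$; vectors $X,Y$ are orthogonal if $\langle X,Y\rangle=0$, and $v$ is light-like if $\langle v,v\rangle=0$. The family of conics confocal with $\mathcal{E}$ is $\mathcal{C}_\lambda:\ \frac{x^2}{a-\lambda}+\frac{y^2}{b+\lambda}=1$, $\lambda\in\mathbb{R}$; $\mathcal{C}_\lambda$ is an ellipse for $\lambda\in(-b,a)$ and a hyperbola for $\lambda<-b$ or $\lambda>a$. Billiard reflection: given a line $p$ that is not light-like and a vector $v$, write $v=u+w$ with $u$ parallel to $p$ and $w$ orthogonal to $p$ (in the Minkowski sense); the reflection of $v$ on $p$ is $u-w$. A billiard trajectory within $\mathcal{E}$ is a polygonal line with vertices on $\mathcal{E}$ such that the directions of consecutive segments are billiard reflections of each other with respect to the tangent line of $\mathcal{E}$ at the common vertex (the reflection is not defined where this tangent line is light-like). All lines containing segments of a given trajectory are tangent to the same conic $\mathcal{C}_\gamma$ of the confocal family, called the caustic of the trajectory; the caustic is non-degenerate when $\gamma\in\mathbb{R}\setminus\{-b,a\}$. A trajectory is $n$-periodic if it closes after $n$ reflections ($n$ is not required to be the minimal such number). *)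

theory Defs
  imports "HOL-Analysis.Analysis" "Jordan_Normal_Form.Determinant"
begin

text \<open>
  The Minkowski plane is \<^typ>\<open>real \<times> real\<close> with the indefinite product below. Lines are
  represented as point sets.
\<close>

definition minkowski :: "real \<times> real \<Rightarrow> real \<times> real \<Rightarrow> real" where
  "minkowski X Y = fst X * fst Y - snd X * snd Y"

definition light_like :: "real \<times> real \<Rightarrow> bool" where
  "light_like v \<longleftrightarrow> minkowski v v = 0"

definition light_like_line :: "(real \<times> real) set \<Rightarrow> bool" where
  "light_like_line L \<longleftrightarrow> (\<exists>P\<in>L. \<exists>Q\<in>L. P \<noteq> Q \<and> light_like (Q - P))"

definition parallel_to_line :: "real \<times> real \<Rightarrow> (real \<times> real) set \<Rightarrow> bool" where
  "parallel_to_line v L \<longleftrightarrow> (\<exists>P\<in>L. \<exists>Q\<in>L. v = Q - P)"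

definition orthogonal_to_line :: "real \<times> real \<Rightarrow> (real \<times> real) set \<Rightarrow> bool" where
  "orthogonal_to_line v L \<longleftrightarrow> (\<forall>P\<in>L. \<forall>Q\<in>L. minkowski v (Q - P) = 0)"

text \<open>
  \<open>billiard_reflection L v r\<close>: the vector \<open>r\<close> is the reflection of \<open>v\<close> on \<open>L\<close>. It is a relation
  because the reflection does not exist when \<open>L\<close> is light-like.
\<close>

definition billiard_reflection ::
    "(real \<times> real) set \<Rightarrow> real \<times> real \<Rightarrow> real \<times> real \<Rightarrow> bool" where
  "billiard_reflection L v r \<longleftrightarrow> \<not> light_like_line L \<and>
     (\<exists>u w. v = u + w \<and> parallel_to_line u L \<and> orthogonal_to_line w L \<and> r = u - w)"

text \<open>
  The conic is meaningful only for \<open>\<mu> \<noteq> a\<close> and \<open>\<mu> \<noteq> -b\<close>; at these two values HOL's division by zero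
  yields an irrelevant set.
\<close>

definition confocal_conic :: "real \<Rightarrow> real \<Rightarrow> real \<Rightarrow> (real \<times> real) set" where
  "confocal_conic a b \<mu> = {(x, y). x\<^sup>2 / (a - \<mu>) + y\<^sup>2 / (b + \<mu>) = 1}"

abbreviation ellipse :: "real \<Rightarrow> real \<Rightarrow> (real \<times> real) set" where
  "ellipse a b \<equiv> confocal_conic a b 0"

definition conic_tangent :: "real \<Rightarrow> real \<Rightarrow> real \<Rightarrow> real \<times> real \<Rightarrow> (real \<times> real) set" where
  "conic_tangent a b \<mu> P = {(x, y). fst P * x / (a - \<mu>) + snd P * y / (b + \<mu>) = 1}"

text \<open>
  Tangency is projective, as it has to be for every trajectory to have a caustic: a segment of a
  trajectory may lie on an asymptote of a hyperbola, which touches it at a point at infinity.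
  The conics are centred at the origin, so the asymptotes are the lines through the origin in the
  directions annihilating the quadratic form; an ellipse has none.
\<close>

definition conic_asymptote :: "real \<Rightarrow> real \<Rightarrow> real \<Rightarrow> (real \<times> real) set \<Rightarrow> bool" where
  "conic_asymptote a b \<mu> L \<longleftrightarrow>
     (\<exists>v. v \<noteq> 0 \<and> (fst v)\<^sup>2 / (a - \<mu>) + (snd v)\<^sup>2 / (b + \<mu>) = 0 \<and> L = span {v})"

definition tangent_to_conic :: "real \<Rightarrow> real \<Rightarrow> real \<Rightarrow> (real \<times> real) set \<Rightarrow> bool" where
  "tangent_to_conic a b \<mu> L \<longleftrightarrow>
     (\<exists>P \<in> confocal_conic a b \<mu>. L = conic_tangent a b \<mu> P) \<or> conic_asymptote a b \<mu> L"

text \<open>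
  A trajectory is given by the bi-infinite sequence of its vertices. At each vertex the reflection
  must exist, so sequences never meet the four points where the tangent of the ellipse is
  light-like.
\<close>

definition billiard_trajectory :: "real \<Rightarrow> real \<Rightarrow> (int \<Rightarrow> real \<times> real) \<Rightarrow> bool" where
  "billiard_trajectory a b p \<longleftrightarrow>
     (\<forall>k. p k \<in> ellipse a b \<and> p k \<noteq> p (k + 1) \<and>
        (\<exists>r c. billiard_reflection (conic_tangent a b 0 (p k)) (p k - p (k - 1)) r \<and>
               c > 0 \<and> p (k + 1) - p k = c *\<^sub>R r))"

definition has_caustic :: "real \<Rightarrow> real \<Rightarrow> real \<Rightarrow> (int \<Rightarrow> real \<times> real) \<Rightarrow> bool" where
  "has_caustic a b \<gamma> p \<longleftrightarrow> (\<forall>k. tangent_to_conic a b \<gamma> (affine hull {p k, p (k + 1)}))"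

definition periodic_trajectory :: "nat \<Rightarrow> (int \<Rightarrow> real \<times> real) \<Rightarrow> bool" where
  "periodic_trajectory n p \<longleftrightarrow> (\<forall>k. p (k + int n) = p k)"

definition taylor_coeff :: "(real \<Rightarrow> real) \<Rightarrow> nat \<Rightarrow> real" where
  "taylor_coeff f k = (deriv ^^ k) f 0 / fact k"

definition B_coeff :: "real \<Rightarrow> real \<Rightarrow> real \<Rightarrow> nat \<Rightarrow> real" where
  "B_coeff a b \<gamma> = taylor_coeff (\<lambda>x. sqrt (sgn \<gamma> * (a - x) * (b + x) * (\<gamma> - x)))"

definition C_coeff :: "real \<Rightarrow> real \<Rightarrow> real \<Rightarrow> nat \<Rightarrow> real" where
  "C_coeff a b \<gamma> = taylor_coeff (\<lambda>x. sqrt (sgn \<gamma> * (a - x) * (b + x) * (\<gamma> - x)) / (\<gamma> - x))"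

text \<open>
  The determinant of the \<open>m \<times> m\<close> matrix with entries \<open>c (i + j + s)\<close> for \<open>1 \<le> i, j \<le> m\<close>; matrix
  indices of \<^const>\<open>Matrix.mat\<close> start at 0, hence the successors.
\<close>

definition hankel_det :: "(nat \<Rightarrow> real) \<Rightarrow> nat \<Rightarrow> nat \<Rightarrow> real" where
  "hankel_det c s m = Determinant.det (Matrix.mat m m (\<lambda>(i, j). c (Suc i + Suc j + s)))"

end

theory Submission
  imports Defs
begin

text \<open>
  A line touching the caustic is recorded by its intersection with a light-like line that touches all
  conics of the family; together with an orientation this gives a point of the cubic
  \<open>w\<^sup>2 (\<gamma> - x) = \<gamma> (a - x) (b + x)\<close>, on which the billiard map is the translation by the difference of the
  points \<open>Q\<^sub>0\<close> over \<open>x = 0\<close> and \<open>Q\<^sub>\<gamma>\<close> over \<open>x = \<gamma>\<close>. Each vertex of a trajectory gives a function linear in \<open>x\<close> and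
  \<open>w\<close>, and the product of these functions along the trajectory has the divisor
  \<open>n (Q\<^sub>0 - Q\<^sub>\<gamma>)\<close> (up to the sign of \<open>w\<close>) plus a contribution of the two ends of the trajectory. Hence the trajectory closes
  after \<open>n\<close> steps iff some function with poles at most \<open>n Q\<^sub>\<gamma>\<close> vanishes to order \<open>n\<close> at \<open>Q\<^sub>0\<close>. Multiplied by
  \<open>(\<gamma> - x) ^ (n div 2)\<close>, it becomes \<open>p - q w\<close> with polynomials \<open>p\<close> and \<open>q\<close> of bounded degree, and their
  existence is a linear condition on Taylor coefficients, expressed by the Hankel determinant.
\<close>

section \<open>Taylor coefficients and Hankel determinants\<close>

text \<open>Neither a group law nor Riemann-Roch enters. Degree bounds control the poles at
  infinity, and divisibility by a power of \<open>fps_X\<close> expresses the zeros over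
  \<open>x = 0\<close>. Exactly two power series, \<open>W\<close> and \<open>- W\<close>, satisfy
  the equation of the cubic; they expand \<open>w\<close> at the two points over
  \<open>x = 0\<close>, and the square root of the theorem enters only through them. The resulting
  linear condition does not mention the trajectory, so one trajectory closes iff all trajectories
  with this caustic do. But the left side of the theorem quantifies over all trajectories and would
  hold vacuously if there were none. Hence a trajectory has to be constructed that meets no
  light-like tangent, forwards or backwards. A second obstacle is that the
  \<open>x\<close>-coordinate determines a chord only up to its orientation.\<close>

lemma fps_nth_eq_taylor_coeff:
  assumes "f has_fps_expansion F"
  shows "fps_nth F n = taylor_coeff f n"
proof -
  have expansion: "(deriv ^^ k) f has_fps_expansion (fps_deriv ^^ k) F" for k
    using assms by (induction k) (auto intro: has_fps_expansion_deriv)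
  have "fps_nth ((fps_deriv ^^ n) F) 0 = (deriv ^^ n) f 0"
    using expansion[of n]
    by (auto simp: has_fps_expansion_def eval_fps_at_0 dest: eventually_nhds_x_imp_x)
  thus ?thesis
    unfolding taylor_coeff_def using fps_0th_higher_deriv[of n F] by (simp add: field_simps)
qed

text \<open>The series is the binomial series with exponent 1/2. Its square follows from the
  uniqueness of expansions, since near 0 the function squares to \<open>1 + d * x\<close>.\<close>

lemma ex_sqrt_linear_fps_expansion:
  fixes d :: real
  obtains F where "(\<lambda>x. sqrt (1 + d * x)) has_fps_expansion F"
    and "F * F = fps_of_poly [:1, d:]"
proof -
  define F where "F = Abs_fps (\<lambda>n. ((1/2 :: real) gchoose n) * d ^ n)"
  have small: "eventually (\<lambda>u::real. \<bar>d * u\<bar> < 1) (nhds 0)"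
  proof -
    have "((\<lambda>u. \<bar>d * u\<bar>) \<longlongrightarrow> \<bar>d * 0\<bar>) (nhds (0::real))"
      by (intro tendsto_intros filterlim_ident)
    thus ?thesis by (rule order_tendstoD) simp
  qed
  hence "eventually (\<lambda>u. (\<lambda>n. fps_nth F n * u ^ n) sums sqrt (1 + d * u)) (nhds 0)"
  proof eventually_elim
    case (elim u)
    thus ?case using sqrt_series[of "d * u"] by (simp add: F_def power_mult_distrib mult_ac)
  qed
  hence F: "(\<lambda>x. sqrt (1 + d * x)) has_fps_expansion F"
    by (rule has_fps_expansionI)
  have "eventually (\<lambda>x. sqrt (1 + d * x) * sqrt (1 + d * x) = 1 + d * x) (nhds 0)"
    using small by eventually_elim (simp add: abs_less_iff)
  with has_fps_expansion_mult[OF F F]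
  have "(\<lambda>x. 1 + d * x) has_fps_expansion F * F"
    by (auto simp: has_fps_expansion_def elim: eventually_elim2)
  moreover have "(\<lambda>x. 1 + d * x) has_fps_expansion 1 + fps_const d * fps_X"
    by (intro fps_expansion_intros)
  ultimately have "F * F = 1 + fps_const d * fps_X"
    by (intro fps_ext) (metis fps_nth_eq_taylor_coeff)
  also have "\<dots> = fps_of_poly [:1, d:]"
    by (simp add: fps_of_poly_linear')
  finally show thesis using F that by blast
qed

text \<open>\<open>W\<close> is the branch of \<open>w\<close> with a positive value at 0. Up to the
  common factor \<open>\<rho>\<close>, the numbers \<open>C_coeff\<close> are the Taylor
  coefficients of \<open>w\<close> and the numbers \<open>B_coeff\<close> those of
  \<open>(\<gamma> - x) w\<close>.\<close>

lemma ex_cubic_sqrt_fps: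
  fixes a b \<gamma> :: real
  assumes "a > 0" "b > 0" "\<gamma> \<noteq> 0"
  obtains W :: "real fps" and \<rho> :: real where "\<rho> \<noteq> 0"
    and "W * W * fps_of_poly [:\<gamma>, -1:] = fps_of_poly (Polynomial.smult \<gamma> ([:a, -1:] * [:b, 1:]))"
    and "fps_nth W 0 = sqrt (a * b)"
    and "\<And>n. fps_nth W n = \<rho> * C_coeff a b \<gamma> n"
    and "\<And>n. fps_nth (W * fps_of_poly [:\<gamma>, -1:]) n = \<rho> * B_coeff a b \<gamma> n"
proof -
  obtain F1 where F1: "(\<lambda>x. sqrt (1 + (-1/a) * x)) has_fps_expansion F1" "F1 * F1 = fps_of_poly [:1, -1/a:]"
    by (rule ex_sqrt_linear_fps_expansion)
  obtain F2 where F2: "(\<lambda>x. sqrt (1 + (1/b) * x)) has_fps_expansion F2" "F2 * F2 = fps_of_poly [:1, 1/b:]"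
    by (rule ex_sqrt_linear_fps_expansion)
  obtain F3 where F3: "(\<lambda>x. sqrt (1 + (-1/\<gamma>) * x)) has_fps_expansion F3" "F3 * F3 = fps_of_poly [:1, -1/\<gamma>:]"
    by (rule ex_sqrt_linear_fps_expansion)
  define r where "r = sqrt (a * b * \<bar>\<gamma>\<bar>)"
  have r: "r * r = a * b * \<bar>\<gamma>\<bar>" "r > 0" using assms by (auto simp: r_def)
  define f where "f x = sqrt (sgn \<gamma> * (a - x) * (b + x) * (\<gamma> - x))" for x
  define Y where "Y = fps_const r * (F1 * (F2 * F3))"
  define G where "G = fps_of_poly [:\<gamma>, -1:]"
  have G0: "fps_nth G 0 = \<gamma>" by (simp add: G_def)
  have "f x = r * (sqrt (1 + (-1/a) * x) * (sqrt (1 + (1/b) * x) * sqrt (1 + (-1/\<gamma>) * x)))" for x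
  proof -
    have "sgn \<gamma> * (a - x) * (b + x) * (\<gamma> - x) =
      (a * b * \<bar>\<gamma>\<bar>) * ((1 + (-1/a) * x) * ((1 + (1/b) * x) * (1 + (-1/\<gamma>) * x)))"
      using assms by (simp add: abs_sgn field_simps)
    \<comment> \<open>\<open>sqrt\<close> is extended to negative reals as an odd function and is
      multiplicative on all reals, so the factorization holds for every \<open>x\<close>.\<close>
    thus ?thesis unfolding f_def r_def by (simp only: real_sqrt_mult)
  qed
  hence "f = (\<lambda>x. r * (sqrt (1 + (-1/a) * x) * (sqrt (1 + (1/b) * x) * sqrt (1 + (-1/\<gamma>) * x))))" by blast
  hence Y: "f has_fps_expansion Y"
    unfolding Y_def using F1(1) F2(1) F3(1)
    by (auto intro!: has_fps_expansion_mult has_fps_expansion_const)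
  have G: "(\<lambda>x. \<gamma> - x) has_fps_expansion G"
  proof -
    have "(\<lambda>x. \<gamma> - x) has_fps_expansion fps_const \<gamma> - fps_X"
      by (intro fps_expansion_intros)
    also have "fps_const \<gamma> - fps_X = G"
      by (simp add: G_def fps_of_poly_pCons)
    finally show ?thesis .
  qed
  have C: "(\<lambda>x. f x / (\<gamma> - x)) has_fps_expansion Y / G"
    using Y G by (rule has_fps_expansion_divide') (use G0 assms in simp)
  have YG: "Y / G * G = Y"
    using G0 assms by (simp add: fps_divide_unit mult.assoc inverse_mult_eq_1)
  have YY: "Y * Y = fps_const (sgn \<gamma>) * fps_of_poly ([:a, -1:] * [:b, 1:]) * G"
  proof -
    have "Y * Y = fps_const (r * r) * ((F1 * F1) * ((F2 * F2) * (F3 * F3)))"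
      by (simp add: Y_def mult_ac flip: fps_const_mult)
    also have "\<dots> = fps_of_poly (Polynomial.smult (a * b * \<bar>\<gamma>\<bar>) ([:1, -1/a:] * ([:1, 1/b:] * [:1, -1/\<gamma>:])))"
      by (simp only: r F1 F2 F3 fps_of_poly_mult fps_of_poly_smult)
    also have "Polynomial.smult (a * b * \<bar>\<gamma>\<bar>) ([:1, -1/a:] * ([:1, 1/b:] * [:1, -1/\<gamma>:])) =
       Polynomial.smult (sgn \<gamma>) ([:a, -1:] * [:b, 1:]) * [:\<gamma>, -1:]"
      using assms by (simp add: abs_sgn field_simps)
    finally show ?thesis by (simp only: G_def fps_of_poly_mult fps_of_poly_smult)
  qed
  \<comment> \<open>The modulus turns the factor \<open>sgn \<gamma>\<close> under the root into the
    factor \<open>\<gamma>\<close> of the cubic. The sign makes \<open>fps_nth W 0\<close> positive,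
    because the quotient has the value \<open>r / \<gamma>\<close> at 0.\<close>
  define \<rho> where "\<rho> = sgn \<gamma> * sqrt \<bar>\<gamma>\<bar>"
  have \<rho>: "\<rho> \<noteq> 0" "\<rho> * \<rho> * sgn \<gamma> = \<gamma>" using assms by (auto simp: \<rho>_def sgn_if)
  define W where "W = fps_const \<rho> * (Y / G)"
  show thesis
  proof (rule that[of \<rho> W])
    have "W * W * G * G = fps_const (\<rho> * \<rho>) * (Y / G * G) * (Y / G * G)"
      by (simp add: W_def mult_ac flip: fps_const_mult)
    also have "\<dots> = fps_const (\<rho> * \<rho> * sgn \<gamma>) * fps_of_poly ([:a, -1:] * [:b, 1:]) * G"
      by (simp add: YG YY mult.assoc flip: fps_const_mult)
    finally have "(W * W * G) * G = fps_of_poly (Polynomial.smult \<gamma> ([:a, -1:] * [:b, 1:])) * G"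
      by (simp only: \<rho> fps_of_poly_smult)
    moreover have "G \<noteq> 0" using G0 assms by auto
    ultimately show "W * W * fps_of_poly [:\<gamma>, -1:] = fps_of_poly (Polynomial.smult \<gamma> ([:a, -1:] * [:b, 1:]))"
      by (simp add: G_def)
    have "fps_nth (Y / G) 0 = taylor_coeff (\<lambda>x. f x / (\<gamma> - x)) 0"
      by (rule fps_nth_eq_taylor_coeff[OF C])
    also have "\<dots> = r / \<gamma>" by (simp add: taylor_coeff_def f_def r_def abs_sgn mult_ac)
    finally have "fps_nth W 0 = \<rho> * r / \<gamma>" by (simp add: W_def)
    also have "\<dots> = sqrt (a * b)" using assms
      by (auto simp: \<rho>_def r_def real_sqrt_mult sgn_if field_simps)
    finally show "fps_nth W 0 = sqrt (a * b)" .
    show "fps_nth W n = \<rho> * C_coeff a b \<gamma> n" for n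
      using fps_nth_eq_taylor_coeff[OF C, of n] by (simp add: W_def C_coeff_def f_def)
    have "W * G = fps_const \<rho> * Y" by (simp add: W_def mult.assoc YG)
    thus "fps_nth (W * fps_of_poly [:\<gamma>, -1:]) n = \<rho> * B_coeff a b \<gamma> n" for n
      using fps_nth_eq_taylor_coeff[OF Y, of n] by (simp add: G_def[symmetric] B_coeff_def f_def[abs_def])
  qed (use \<rho> in simp)
qed

text \<open>Reversing the coefficients of \<open>q\<close> turns the convolution into a Hankel row
  times a vector: for \<open>k = r - 1 - j\<close> the index \<open>r + 1 + s + i - k\<close>
  becomes \<open>Suc i + Suc j + s\<close>.\<close>

lemma fps_nth_poly_mult_eq_sum:
  fixes F :: "'a :: comm_ring_1 fps"
  assumes "degree q < r"
  shows "fps_nth (fps_of_poly q * F) (r + 1 + s + i) =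
    (\<Sum>j<r. fps_nth F (Suc i + Suc j + s) * coeff q (r - 1 - j))"
proof -
  have "fps_nth (fps_of_poly q * F) (r + 1 + s + i) =
      (\<Sum>k=0..r + 1 + s + i. coeff q k * fps_nth F (r + 1 + s + i - k))"
    by (simp add: fps_mult_nth)
  also have "\<dots> = (\<Sum>k<r. coeff q k * fps_nth F (r + 1 + s + i - k))"
    proof (rule sum.mono_neutral_right)
    show "\<forall>k\<in>{0..r + 1 + s + i} - {..<r}. coeff q k * fps_nth F (r + 1 + s + i - k) = 0"
      using assms by (simp add: coeff_eq_0)
  qed auto
  also have "\<dots> = (\<Sum>j<r. fps_nth F (Suc i + Suc j + s) * coeff q (r - 1 - j))"
  proof (rule sum.reindex_bij_witness[of _ "\<lambda>j. r - 1 - j" "\<lambda>j. r - 1 - j"])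
    fix k assume "k \<in> {..<r}"
    hence "Suc i + Suc (r - 1 - k) + s = r + 1 + s + i - k" "r - 1 - (r - 1 - k) = k" by auto
    thus "fps_nth F (Suc i + Suc (r - 1 - k) + s) * coeff q (r - 1 - (r - 1 - k)) =
      coeff q k * fps_nth F (r + 1 + s + i - k)" by (simp only: mult.commute)
  qed auto
  finally show ?thesis .
qed

lemma hankel_det_eq_0_iff:
  "hankel_det (fps_nth F) s r = 0 \<longleftrightarrow>
    (\<exists>q. q \<noteq> 0 \<and> degree q < r \<and> (\<forall>i<r. fps_nth (fps_of_poly q * F) (r + 1 + s + i) = 0))"
proof -
  define A where "A = Matrix.mat r r (\<lambda>(i, j). fps_nth F (Suc i + Suc j + s))"
  have A: "A \<in> carrier_mat r r" by (simp add: A_def)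
  have Av: "(A *\<^sub>v v) $ i = (\<Sum>j<r. fps_nth F (Suc i + Suc j + s) * v $ j)"
    if "v \<in> carrier_vec r" "i < r" for v i
    using that by (auto simp: A_def scalar_prod_def lessThan_atLeast0)
  have "hankel_det (fps_nth F) s r = 0 \<longleftrightarrow>
      (\<exists>v. v \<in> carrier_vec r \<and> v \<noteq> 0\<^sub>v r \<and> A *\<^sub>v v = 0\<^sub>v r)"
    using det_0_iff_vec_prod_zero_field[OF A] by (simp add: hankel_det_def A_def)
  also have "\<dots> \<longleftrightarrow> (\<exists>q. q \<noteq> 0 \<and> degree q < r \<and>
      (\<forall>i<r. fps_nth (fps_of_poly q * F) (r + 1 + s + i) = 0))"
  proof safe
    fix v assume v: "v \<in> carrier_vec r" "v \<noteq> 0\<^sub>v r" "A *\<^sub>v v = 0\<^sub>v r"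
    obtain j where j: "j < r" "v $ j \<noteq> 0"
      using v(1,2) by (metis carrier_vecD eq_vecI index_zero_vec)
    define q where "q = (\<Sum>j<r. monom (v $ j) (r - 1 - j))"
    have coeff_q: "coeff q (r - 1 - i) = v $ i" if "i < r" for i
    proof -
      have "coeff q (r - 1 - i) = (\<Sum>j<r. if j = i then v $ j else 0)"
        unfolding q_def coeff_sum using that by (intro sum.cong) (auto simp: coeff_monom)
      thus ?thesis using that by simp
    qed
    have "degree q \<le> r - 1"
      unfolding q_def by (intro degree_sum_le) (auto intro: order_trans[OF degree_monom_le])
    hence deg: "degree q < r" using j by simp
    moreover have "q \<noteq> 0" using coeff_q[OF j(1)] j(2) by auto
    moreover have "fps_nth (fps_of_poly q * F) (r + 1 + s + i) = 0" if "i < r" for i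
    proof -
      have "fps_nth (fps_of_poly q * F) (r + 1 + s + i) = (A *\<^sub>v v) $ i"
        unfolding fps_nth_poly_mult_eq_sum[OF deg] Av[OF v(1) that]
        using coeff_q by (intro sum.cong) auto
      thus ?thesis using v(3) that by simp
    qed
    ultimately show "\<exists>q. q \<noteq> 0 \<and> degree q < r \<and>
      (\<forall>i<r. fps_nth (fps_of_poly q * F) (r + 1 + s + i) = 0)" by blast
  next
    fix q :: "real poly"
    assume q: "q \<noteq> 0" "degree q < r" "\<forall>i<r. fps_nth (fps_of_poly q * F) (r + 1 + s + i) = 0"
    define v where "v = Matrix.vec r (\<lambda>j. coeff q (r - 1 - j))"
    have "v \<noteq> 0\<^sub>v r"
    proof
      assume "v = 0\<^sub>v r"
      hence "v $ (r - 1 - degree q) = 0" using q(2) by simp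
      thus False using q(1,2) by (simp add: v_def)
    qed
    moreover have "v \<in> carrier_vec r" by (simp add: v_def)
    moreover have "A *\<^sub>v v = 0\<^sub>v r"
    proof (rule eq_vecI)
      fix i assume "i < dim_vec (0\<^sub>v r :: real vec)"
      hence i: "i < r" by simp
      show "(A *\<^sub>v v) $ i = 0\<^sub>v r $ i"
      proof -
        have "(A *\<^sub>v v) $ i = fps_nth (fps_of_poly q * F) (r + 1 + s + i)"
          unfolding fps_nth_poly_mult_eq_sum[OF q(2)] Av[OF \<open>v \<in> carrier_vec r\<close> i]
          by (intro sum.cong) (auto simp: v_def)
        thus ?thesis using q(3) i by simp
      qed
    qed (simp add: A_def)
    ultimately show "\<exists>v. v \<in> carrier_vec r \<and> v \<noteq> 0\<^sub>v r \<and> A *\<^sub>v v = 0\<^sub>v r" by blast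
  qed
  finally show ?thesis .
qed

lemma fps_X_power_dvd_iff_nth:
  fixes F :: "'a :: field fps"
  shows "fps_X ^ n dvd F \<longleftrightarrow> (\<forall>i<n. fps_nth F i = 0)"
proof (cases "F = 0")
  case False
  hence "fps_X ^ n dvd F \<longleftrightarrow> n \<le> subdegree F" by (simp add: fps_dvd_iff)
  also have "\<dots> \<longleftrightarrow> (\<forall>i<n. fps_nth F i = 0)"
    using False by (meson less_le_trans nth_less_subdegree_zero subdegree_geI)
  finally show ?thesis .
qed simp

text \<open>The free coefficients of \<open>p\<close> absorb those of \<open>q * F\<close> up to
  index \<open>n div 2\<close>. Of the \<open>n\<close> vanishing conditions there remain
  \<open>(n - 1) div 2\<close>, as many as \<open>q\<close> has coefficients, so the system is
  square. The shift by 1 for even \<open>n\<close> lets the Hankel block start at index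
  \<open>n div 2 + 1\<close>.\<close>

lemma hankel_det_eq_0_iff_pade:
  assumes "n \<ge> 3"
  shows "hankel_det (fps_nth F) (if even n then 1 else 0) ((n - 1) div 2) = 0 \<longleftrightarrow>
    (\<exists>p q. (p \<noteq> 0 \<or> q \<noteq> 0) \<and> degree p \<le> n div 2 \<and> degree q \<le> (n - 3) div 2 \<and>
       fps_X ^ n dvd fps_of_poly p - fps_of_poly q * F)"
proof -
  define r where "r = (n - 1) div 2"
  define s :: nat where "s = (if even n then 1 else 0)"
  have n: "r + 1 + s = n div 2 + 1" "n div 2 + 1 + r = n" "r > 0" "(n - 3) div 2 = r - 1"
    using assms unfolding r_def s_def by (cases "even n"; simp; presburger)+
  have "hankel_det (fps_nth F) s r = 0 \<longleftrightarrow> (\<exists>q. q \<noteq> 0 \<and> degree q < r \<and>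
      (\<forall>i<r. fps_nth (fps_of_poly q * F) (n div 2 + 1 + i) = 0))"
    unfolding hankel_det_eq_0_iff n ..
  also have "\<dots> \<longleftrightarrow> (\<exists>p q. (p \<noteq> 0 \<or> q \<noteq> 0) \<and> degree p \<le> n div 2 \<and> degree q \<le> (n - 3) div 2 \<and>
       fps_X ^ n dvd fps_of_poly p - fps_of_poly q * F)"
  proof (intro iffI; elim exE conjE)
    fix q assume q: "q \<noteq> 0" "degree q < r" and
      q3: "\<forall>i<r. fps_nth (fps_of_poly q * F) (n div 2 + 1 + i) = 0"
    define p where "p = truncate_fps (n div 2 + 1) (fps_of_poly q * F)"
    have "degree p < n div 2 + 1"
      unfolding p_def by (rule degree_truncate_fps) simp
    moreover have "fps_nth (fps_of_poly p - fps_of_poly q * F) i = 0" if "i < n" for i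
    proof (cases "i < n div 2 + 1")
      case False
      then obtain j where j: "i = n div 2 + 1 + j" using le_Suc_ex not_less by blast
      with that n have "j < r" by linarith
      with q3 j False show ?thesis by (simp add: p_def)
    qed (simp add: p_def)
    moreover have "degree q \<le> (n - 3) div 2" using q(2) n by linarith
    ultimately show "\<exists>p q. (p \<noteq> 0 \<or> q \<noteq> 0) \<and> degree p \<le> n div 2 \<and> degree q \<le> (n - 3) div 2 \<and>
       fps_X ^ n dvd fps_of_poly p - fps_of_poly q * F"
      using q(1) unfolding fps_X_power_dvd_iff_nth
      by (intro exI[of _ p] exI[of _ q]) auto
  next
    fix p q :: "real poly"
    assume *: "degree p \<le> n div 2" "degree q \<le> (n - 3) div 2"
       "fps_X ^ n dvd fps_of_poly p - fps_of_poly q * F" and nz: "p \<noteq> 0 \<or> q \<noteq> 0"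
    have eq: "coeff p i = fps_nth (fps_of_poly q * F) i" if "i < n" for i
      using *(3) that unfolding fps_X_power_dvd_iff_nth by simp
    have "n div 2 < n" using assms by simp
    have "q \<noteq> 0"
    proof
      assume "q = 0"
      hence "coeff p i = 0" for i
        using eq[of i] *(1) coeff_eq_0[of p i] \<open>n div 2 < n\<close> by (cases "i < n") auto
      thus False using \<open>q = 0\<close> nz by (simp add: poly_eq_iff)
    qed
    moreover have "degree q < r" using *(2) n by linarith
    moreover have "fps_nth (fps_of_poly q * F) (n div 2 + 1 + i) = 0" if "i < r" for i
    proof -
      have "n div 2 + 1 + i < n" using that n(2) by linarith
      thus ?thesis using eq[of "n div 2 + 1 + i"] *(1) by (simp add: coeff_eq_0)
    qed
    ultimately show "\<exists>q. q \<noteq> 0 \<and> degree q < r \<and>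
      (\<forall>i<r. fps_nth (fps_of_poly q * F) (n div 2 + 1 + i) = 0)" by blast
  qed
  finally show ?thesis unfolding r_def s_def .
qed

section \<open>Functions on the cubic along a chain of chords\<close>

text \<open>
  The chord of the ellipse joining the points with parameters \<open>u\<close> and \<open>s\<close> (see \<open>ellipse_point\<close> below)
  meets the light-like line \<open>x + y = sqrt (a + b)\<close>, which touches every conic of the confocal family,
  at its point of contact with \<open>C\<^sub>\<lambda>\<close> for \<open>\<lambda> = param_x t u s\<close>, where \<open>t = sqrt (a * b)\<close>. If the chord
  touches the caustic, then \<open>(param_x t u s, param_w t u s)\<close> lies on the cubic
  \<open>w\<^sup>2 (\<gamma> - x) = \<gamma> (a - x) (b + x)\<close>, and exchanging the ends of the chord changes the sign of \<open>w\<close>.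
\<close>

definition param_x :: "real \<Rightarrow> real \<Rightarrow> real \<Rightarrow> real" where
  "param_x t u s = - 2 * t / (u + s)"

definition param_w :: "real \<Rightarrow> real \<Rightarrow> real \<Rightarrow> real" where
  "param_w t u s = t * (u - s) / (u + s)"

definition chord_x :: "real \<Rightarrow> (nat \<Rightarrow> real) \<Rightarrow> nat \<Rightarrow> real" where
  "chord_x t s k = param_x t (s k) (s (Suc k))"

definition chord_w :: "real \<Rightarrow> (nat \<Rightarrow> real) \<Rightarrow> nat \<Rightarrow> real" where
  "chord_w t s k = param_w t (s k) (s (Suc k))"

text \<open>
  The function \<open>vertex_poly t s k + w\<close> on the cubic belongs to the common vertex of the chords \<open>k\<close> and \<open>k + 1\<close>:
  its zeros are chord \<open>k + 1\<close>, chord \<open>k\<close> with its ends exchanged, and the point \<open>(0, - t)\<close>.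
\<close>

definition vertex_poly :: "real \<Rightarrow> (nat \<Rightarrow> real) \<Rightarrow> nat \<Rightarrow> real poly" where
  "vertex_poly t s k = [:t, s (Suc k):]"

text \<open>All that the argument on the cubic \<open>w^2 g = f\<close> needs from geometry. The
  left side of the identity is \<open>g\<close> times the norm \<open>(l + w) (l - w)\<close> of a
  vertex function \<open>l + w\<close>, and the right side factors it over the three zeros. The
  first condition keeps the divisions in the chord coordinates meaningful.\<close>

definition chain :: "real poly \<Rightarrow> real poly \<Rightarrow> real \<Rightarrow> (nat \<Rightarrow> real) \<Rightarrow> nat \<Rightarrow> bool" where
  "chain f g t s m \<longleftrightarrow> (\<forall>k\<le>m. s k + s (Suc k) \<noteq> 0) \<and>
    (\<forall>k<m. vertex_poly t s k * vertex_poly t s k * g - f =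
       Polynomial.smult (- (s (Suc k))\<^sup>2) ([:0, 1:] * [:- chord_x t s k, 1:] * [:- chord_x t s (Suc k), 1:]))"

text \<open>
  With \<open>g = \<gamma> - x\<close>, the product of \<open>w\<close> and the factor below has near \<open>x = 0\<close>, up to a constant, the Taylor
  coefficients \<open>B_coeff\<close> for even \<open>m\<close> and \<open>C_coeff\<close> for odd \<open>m\<close>.
\<close>

definition parity_factor :: "real poly \<Rightarrow> nat \<Rightarrow> real poly" where
  "parity_factor g m = (if even m then g else 1)"

lemma parity_factor_mult_Suc: "parity_factor g m * parity_factor g (Suc m) = g"
  by (simp add: parity_factor_def)

lemma poly_vertex_poly_chord:
  assumes "s k + s (Suc k) \<noteq> 0"
  shows "poly (vertex_poly t s k) (chord_x t s k) = chord_w t s k"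
  using assms by (simp add: vertex_poly_def chord_x_def param_x_def chord_w_def param_w_def field_simps)

lemma poly_vertex_poly_chord_Suc:
  assumes "s (Suc k) + s (Suc (Suc k)) \<noteq> 0"
  shows "poly (vertex_poly t s k) (chord_x t s (Suc k)) = - chord_w t s (Suc k)"
  using assms by (simp add: vertex_poly_def chord_x_def param_x_def chord_w_def param_w_def field_simps)

lemma chain_mono: "chain f g t s m \<Longrightarrow> k \<le> m \<Longrightarrow> chain f g t s k"
  by (auto simp: chain_def)

lemma degree_add_mult_le:
  fixes p q r :: "'a :: comm_ring_1 poly"
  shows "degree p \<le> n \<Longrightarrow> degree q + degree r \<le> n \<Longrightarrow> degree (p + q * r) \<le> n"
  by (meson degree_add_le degree_mult_le order_trans)

text \<open>
  The product of the vertex functions, with the intermediate chords divided out, is a function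
  \<open>P + Q w\<close> with zeros at the last chord, at the first chord reversed, and \<open>m\<close> times at \<open>(0, - t)\<close>. The statement
  contains only the first of these three; the others come out of the product formula later.
\<close>

lemma chain_function:
  assumes "chain f g t s m" "m \<ge> 1" "degree g \<le> 1"
  shows "\<exists>P Q. degree P \<le> m div 2 + 1 \<and> degree Q \<le> (m - 1) div 2 \<and>
    poly P (chord_x t s m) + poly (Q * parity_factor g m) (chord_x t s m) * chord_w t s m = 0 \<and>
    (\<forall>V. V * V * fps_of_poly g = fps_of_poly f \<longrightarrow>
      (fps_of_poly P + fps_of_poly (Q * parity_factor g m) * V) *
        fps_of_poly (\<Prod>i=1..<m. [:- chord_x t s i, 1:]) =
      fps_of_poly g ^ (m div 2) * (\<Prod>i<m. fps_of_poly (vertex_poly t s i) + V))"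
  using assms(2,1)
proof (induction m rule: nat_induct_at_least)
  case base
  have "poly (vertex_poly t s 0) (chord_x t s 1) = - chord_w t s 1"
    using base poly_vertex_poly_chord_Suc[of s 0 t] by (simp add: chain_def)
  thus ?case
    by (intro exI[of _ "vertex_poly t s 0"] exI[of _ 1])
       (auto simp: parity_factor_def vertex_poly_def)
next
  case (Suc m)
  define k where "k = parity_factor g m"
  define k' where "k' = parity_factor g (Suc m)"
  define l where "l = vertex_poly t s m"
  define x where "x = chord_x t s m"
  define x' where "x' = chord_x t s (Suc m)"
  define D where "D = (\<Prod>i=1..<m. [:- chord_x t s i, 1:])"
  have kk: "k * k' = g" unfolding k_def k'_def by (rule parity_factor_mult_Suc)
  have nz: "s m + s (Suc m) \<noteq> 0" "s (Suc m) + s (Suc (Suc m)) \<noteq> 0"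
    using Suc.prems by (auto simp: chain_def)
  define c where "c = [:(s (Suc m))\<^sup>2:]"
  define X X1 X2 :: "real poly" where "X = [:0, 1:]" and "X1 = [:-x, 1:]" and "X2 = [:-x', 1:]"
  have l: "l * l * g - f = - (c * X * X1 * X2)"
  proof -
    have "l * l * g - f = Polynomial.smult (- (s (Suc m))\<^sup>2) (X * X1 * X2)"
      using Suc.prems unfolding chain_def l_def x_def x'_def X_def X1_def X2_def by blast
    thus ?thesis by (simp add: c_def mult.assoc)
  qed
  have deg_k: "degree k \<le> (if even m then 1 else 0)" "degree k' \<le> (if even m then 0 else 1)"
    using assms(3) by (auto simp: k_def k'_def parity_factor_def)
  have deg_l: "degree l \<le> 1" by (simp add: l_def vertex_poly_def)
  obtain P Q where PQ: "degree P \<le> m div 2 + 1" "degree Q \<le> (m - 1) div 2"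
    "poly P x + poly (Q * k) x * chord_w t s m = 0"
    and prod: "\<And>V. V * V * fps_of_poly g = fps_of_poly f \<Longrightarrow>
      (fps_of_poly P + fps_of_poly (Q * k) * V) * fps_of_poly D =
      fps_of_poly g ^ (m div 2) * (\<Prod>i<m. fps_of_poly (vertex_poly t s i) + V)"
    using Suc.IH chain_mono[OF Suc.prems] unfolding k_def x_def D_def by (auto simp del: poly_mult)
  \<comment> \<open>This polynomial is the coefficient of \<open>w\<close> in
    \<open>(P + Q k w) (l + w)\<close>. At chord \<open>m\<close> the values of \<open>l\<close> and
    \<open>w\<close> agree, so it vanishes there together with the old function.\<close>
  have "poly (P + Q * k * l) x = 0"
    using PQ(3) poly_vertex_poly_chord[of s m t] nz unfolding l_def x_def by (simp add: k_def)
  then obtain V where V: "P + Q * k * l = X1 * V"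
    unfolding poly_eq_0_iff_dvd X1_def by (elim dvdE)
  \<comment> \<open>\<open>X1 * U\<close> is \<open>k'\<close> times the part of
    \<open>(P + Q k w) (l + w)\<close> without \<open>w\<close>, after \<open>k k' w^2 = f\<close>.
    The factored norm of \<open>l + w\<close> makes the division by \<open>X1\<close>
    explicit.\<close>
  define U where "U = k' * l * V + c * Q * X * X2"
  have U: "X1 * U = k' * l * P + Q * f"
  proof -
    have "X1 * U = k' * l * (X1 * V) + Q * (c * X * X1 * X2)"
      by (simp add: U_def algebra_simps)
    also have "\<dots> = k' * l * (P + Q * k * l) - Q * (l * l * (k * k') - f)"
      by (simp only: V kk l)
    also have "\<dots> = k' * l * P + Q * f" by (simp add: algebra_simps)
    finally show ?thesis .
  qed
  have deg_V: "degree V \<le> m div 2"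
  proof (cases "V = 0")
    case False
    have "degree (Q * k) + degree l \<le> m div 2 + 1"
      using degree_mult_le[of Q k] PQ(2) deg_k(1) deg_l Suc.hyps
      by (cases "even m") (auto elim!: evenE oddE)
    hence "degree (X1 * V) \<le> m div 2 + 1"
      unfolding V[symmetric] by (intro degree_add_mult_le PQ)
    moreover have "degree (X1 * V) = Suc (degree V)"
      using False by (subst degree_mult_eq) (auto simp: X1_def)
    ultimately show ?thesis by simp
  qed simp
  have deg_U: "degree U \<le> Suc m div 2 + 1"
    unfolding U_def
  proof (rule degree_add_le)
    have "degree (k' * l * V) \<le> degree k' + degree l + degree V"
      by (meson add_le_mono degree_mult_le le_refl order_trans)
    also have "\<dots> \<le> Suc m div 2 + 1"
      using deg_V deg_k(2) deg_l by (cases "even m") (auto elim!: evenE oddE)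
    finally show "degree (k' * l * V) \<le> Suc m div 2 + 1" .
    have "degree (c * Q * X * X2) \<le> degree c + degree Q + degree X + degree X2"
      by (meson add_le_mono degree_mult_le le_refl order_trans)
    also have "\<dots> \<le> Suc m div 2 + 1"
      using PQ(2) Suc.hyps by (simp add: c_def X_def X2_def)
    finally show "degree (c * Q * X * X2) \<le> Suc m div 2 + 1" .
  qed
  have "poly U x' + poly (V * k') x' * chord_w t s (Suc m) = 0"
    using poly_vertex_poly_chord_Suc[of s m t] nz unfolding l_def x'_def U_def k'_def X2_def by simp
  moreover have "(fps_of_poly U + fps_of_poly (V * k') * W) *
        fps_of_poly (\<Prod>i=1..<Suc m. [:- chord_x t s i, 1:]) =
      fps_of_poly g ^ (Suc m div 2) * (\<Prod>i<Suc m. fps_of_poly (vertex_poly t s i) + W)"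
    if W: "W * W * fps_of_poly g = fps_of_poly f" for W
  proof -
    let ?F = fps_of_poly
    have UX: "?F U * ?F X1 = ?F k' * ?F l * ?F P + ?F Q * (W * W * (?F k * ?F k'))"
      using arg_cong[OF U, of ?F] W
      by (simp only: fps_of_poly_mult fps_of_poly_add kk[symmetric]) (simp add: mult_ac)
    have VX: "?F V * ?F X1 = ?F P + ?F Q * ?F k * ?F l"
      using arg_cong[OF V, of ?F] by (simp only: fps_of_poly_mult fps_of_poly_add) (simp add: mult_ac)
    have "(?F U + ?F (V * k') * W) * (?F X1 * ?F D) =
      (?F U * ?F X1 + (?F V * ?F X1) * ?F k' * W) * ?F D"
      by (simp add: fps_of_poly_mult algebra_simps)
    also have "\<dots> = ?F k' * ((?F P + ?F (Q * k) * W) * ?F D) * (?F l + W)"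
      unfolding UX VX by (simp add: fps_of_poly_mult algebra_simps)
    also have "\<dots> = (?F k' * ?F g ^ (m div 2)) * ((\<Prod>i<m. ?F (vertex_poly t s i) + W) * (?F l + W))"
      unfolding prod[OF W] by (simp only: mult_ac)
    also have "?F k' * ?F g ^ (m div 2) = ?F g ^ (Suc m div 2)"
      unfolding k'_def parity_factor_def by (cases "even m") (auto elim!: evenE oddE)
    also have "?F X1 * ?F D = ?F (\<Prod>i=1..<Suc m. [:- chord_x t s i, 1:])"
      using Suc.hyps unfolding fps_of_poly_mult[symmetric] D_def x_def X1_def
      by (simp add: prod.atLeastLessThan_Suc mult.commute)
    finally show ?thesis by (simp add: l_def)
  qed
  ultimately show ?case
    using deg_U deg_V unfolding k'_def x'_def
    by (intro exI[of _ U] exI[of _ V]) auto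
qed

lemma chord_x_rev:
  "i \<le> m \<Longrightarrow> chord_x t (\<lambda>i. s (Suc m - i)) i = chord_x t s (m - i)"
  by (simp add: chord_x_def param_x_def Suc_diff_le add.commute)

lemma chain_rev:
  assumes "chain f g t s m"
  shows "chain f g t (\<lambda>i. s (Suc m - i)) m"
  unfolding chain_def
proof (intro conjI allI impI)
  fix k assume "k \<le> m"
  thus "s (Suc m - k) + s (Suc m - Suc k) \<noteq> 0"
    using assms by (simp add: chain_def Suc_diff_le add.commute)
next
  fix k assume k: "k < m"
  define j where "j = m - Suc k"
  have j: "j < m" "m - k = Suc j" using k by (auto simp: j_def)
  have "vertex_poly t (\<lambda>i. s (Suc m - i)) k = vertex_poly t s j"
    using k j by (simp add: vertex_poly_def)
  moreover have "chord_x t (\<lambda>i. s (Suc m - i)) k = chord_x t s (Suc j)"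
    using chord_x_rev[of k m t s] k j by simp
  moreover have "chord_x t (\<lambda>i. s (Suc m - i)) (Suc k) = chord_x t s j"
    using chord_x_rev[of "Suc k" m t s] k by (simp add: j_def)
  moreover have "vertex_poly t s j * vertex_poly t s j * g - f =
      Polynomial.smult (- (s (Suc j))\<^sup>2) ([:0, 1:] * [:- chord_x t s j, 1:] * [:- chord_x t s (Suc j), 1:])"
    using assms j unfolding chain_def by blast
  ultimately show "vertex_poly t (\<lambda>i. s (Suc m - i)) k * vertex_poly t (\<lambda>i. s (Suc m - i)) k * g - f =
      Polynomial.smult (- (s (Suc m - Suc k))\<^sup>2) ([:0, 1:] *
        [:- chord_x t (\<lambda>i. s (Suc m - i)) k, 1:] * [:- chord_x t (\<lambda>i. s (Suc m - i)) (Suc k), 1:])"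
    using j by (simp only: mult_ac diff_Suc_Suc)
qed

lemma fps_X_power_dvd_prod:
  fixes F :: "nat \<Rightarrow> 'a :: field fps"
  assumes "\<And>i. i < m \<Longrightarrow> fps_nth (F i) 0 = 0"
  shows "fps_X ^ m dvd (\<Prod>i<m. F i)"
  using assms
proof (induction m)
  case (Suc m)
  have "fps_X ^ 1 dvd F m"
    using Suc.prems[of m] unfolding fps_X_power_dvd_iff_nth by simp
  moreover have "fps_X ^ m dvd (\<Prod>i<m. F i)" using Suc by simp
  ultimately show ?case
    using mult_dvd_mono by (simp add: mult.commute[of fps_X]) blast
qed simp

lemma fps_dvd_mult_unit_cancel:
  fixes A B C :: "'a :: field fps"
  assumes "A dvd B * C" "fps_nth C 0 \<noteq> 0"
  shows "A dvd B"
proof -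
  have "B = B * C * inverse C" using assms(2) by (simp add: mult.assoc inverse_mult_eq_1')
  thus ?thesis using assms(1) by (metis dvd_mult2)
qed

text \<open>The two branches \<open>W\<close> and \<open>- W\<close> separate the even and the odd
  part in \<open>w\<close>.\<close>

lemma fps_pair_eqD:
  fixes W :: "'a :: field_char_0 fps"
  assumes "fps_of_poly P + fps_of_poly Q * W = fps_of_poly P' + fps_of_poly Q' * W"
    and "fps_of_poly P + fps_of_poly Q * (- W) = fps_of_poly P' + fps_of_poly Q' * (- W)"
    and "W \<noteq> 0"
  shows "P = P'" "Q = Q'"
proof -
  have "2 * fps_of_poly P = 2 * fps_of_poly P'"
    using arg_cong2[OF assms(1,2), of "(+)"] by (simp add: algebra_simps)
  thus "P = P'" by (simp add: fps_of_poly_eq_iff)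
  with assms(1,3) show "Q = Q'" by (simp add: fps_of_poly_eq_iff)
qed

text \<open>
  The zero at the reversed first chord is the zero at the last chord of the reversed chain, whose
  product of vertex functions is the same.
\<close>

lemma chain_function_both_ends:
  assumes "chain f g t s m" "m \<ge> 1" "degree g \<le> 1"
    and W: "W * W * fps_of_poly g = fps_of_poly f" "fps_nth W 0 = t"
    and "t \<noteq> 0" "poly g 0 \<noteq> 0"
  shows "\<exists>P Q. degree P \<le> m div 2 + 1 \<and> degree Q \<le> (m - 1) div 2 \<and> (P \<noteq> 0 \<or> Q \<noteq> 0) \<and>
    poly P (chord_x t s m) + poly (Q * parity_factor g m) (chord_x t s m) * chord_w t s m = 0 \<and>
    poly P (chord_x t s 0) - poly (Q * parity_factor g m) (chord_x t s 0) * chord_w t s 0 = 0 \<and>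
    fps_X ^ m dvd fps_of_poly P - fps_of_poly (Q * parity_factor g m) * W"
proof -
  define k where "k = parity_factor g m"
  define D where "D = fps_of_poly (\<Prod>i=1..<m. [:- chord_x t s i, 1:])"
  define s' where "s' = (\<lambda>i. s (Suc m - i))"
  obtain P Q where PQ: "degree P \<le> m div 2 + 1" "degree Q \<le> (m - 1) div 2"
    "poly P (chord_x t s m) + poly (Q * k) (chord_x t s m) * chord_w t s m = 0"
    and prod: "\<And>V. V * V * fps_of_poly g = fps_of_poly f \<Longrightarrow>
      (fps_of_poly P + fps_of_poly (Q * k) * V) * D =
      fps_of_poly g ^ (m div 2) * (\<Prod>i<m. fps_of_poly (vertex_poly t s i) + V)"
    using chain_function[OF assms(1-3)] unfolding k_def D_def by blast
  obtain P' Q' where PQ':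
    "poly P' (chord_x t s' m) + poly (Q' * k) (chord_x t s' m) * chord_w t s' m = 0"
    and prod': "\<And>V. V * V * fps_of_poly g = fps_of_poly f \<Longrightarrow>
      (fps_of_poly P' + fps_of_poly (Q' * k) * V) * fps_of_poly (\<Prod>i=1..<m. [:- chord_x t s' i, 1:]) =
      fps_of_poly g ^ (m div 2) * (\<Prod>i<m. fps_of_poly (vertex_poly t s' i) + V)"
    using chain_function[OF chain_rev[OF assms(1)] assms(2,3)] unfolding k_def s'_def by blast
  have nz: "s i + s (Suc i) \<noteq> 0" if "i \<le> m" for i
    using assms(1) that by (simp add: chain_def)
  have D': "fps_of_poly (\<Prod>i=1..<m. [:- chord_x t s' i, 1:]) = D"
    unfolding D_def s'_def
    by (intro arg_cong[of _ _ fps_of_poly] prod.reindex_bij_witness[of _ "\<lambda>i. m - i" "\<lambda>i. m - i"])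
       (auto simp: chord_x_rev)
  have L': "(\<Prod>i<m. fps_of_poly (vertex_poly t s' i) + V) = (\<Prod>i<m. fps_of_poly (vertex_poly t s i) + V)" for V
    by (intro prod.reindex_bij_witness[of _ "\<lambda>i. m - Suc i" "\<lambda>i. m - Suc i"])
       (auto simp: vertex_poly_def s'_def Suc_diff_Suc)
  have D0: "fps_nth D 0 \<noteq> 0"
    using nz assms(6) by (simp add: D_def poly_prod chord_x_def param_x_def flip: poly_0_coeff_0)
  hence "D \<noteq> 0" by auto
  have W0: "W \<noteq> 0" using W(2) assms(6) by auto
  have Wm: "- W * - W * fps_of_poly g = fps_of_poly f" using W(1) by simp
  have "(fps_of_poly P + fps_of_poly (Q * k) * V) = (fps_of_poly P' + fps_of_poly (Q' * k) * V)"
    if "V * V * fps_of_poly g = fps_of_poly f" for V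
  proof -
    have "(fps_of_poly P + fps_of_poly (Q * k) * V) * D = (fps_of_poly P' + fps_of_poly (Q' * k) * V) * D"
      unfolding prod[OF that] prod'[OF that, unfolded D' L'] ..
    thus ?thesis using \<open>D \<noteq> 0\<close> by simp
  qed
  note pair_eq = this[OF W(1)] this[OF Wm]
  have eq: "P = P'" "Q * k = Q' * k"
    by (rule fps_pair_eqD[OF pair_eq W0])+
  have "chord_x t s' m = chord_x t s 0" "chord_w t s' m = - chord_w t s 0"
  proof -
    have "t * (s 1 - s 0) = - (t * (s 0 - s 1))" by (simp add: algebra_simps)
    thus "chord_w t s' m = - chord_w t s 0"
      by (simp add: s'_def chord_w_def param_w_def add.commute)
  qed (simp add: s'_def chord_x_def param_x_def add.commute)
  with PQ' have left: "poly P (chord_x t s 0) - poly (Q * k) (chord_x t s 0) * chord_w t s 0 = 0"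
    unfolding eq by simp
  have "P \<noteq> 0 \<or> Q \<noteq> 0"
  proof (rule ccontr)
    assume "\<not> (P \<noteq> 0 \<or> Q \<noteq> 0)"
    with prod[OF W(1)] have "fps_of_poly g ^ (m div 2) * (\<Prod>i<m. fps_of_poly (vertex_poly t s i) + W) = 0"
      by simp
    moreover have "fps_nth (fps_of_poly (vertex_poly t s i) + W) 0 \<noteq> 0" for i
      using W(2) assms(6) by (simp add: vertex_poly_def)
    hence "fps_of_poly (vertex_poly t s i) + W \<noteq> 0" for i
      by (metis fps_zero_nth)
    moreover have "fps_of_poly g \<noteq> 0" using assms(7) by auto
    ultimately show False by simp
  qed
  \<comment> \<open>On the branch \<open>- W\<close> each vertex function has constant term
    \<open>t - t = 0\<close>, which gives the \<open>m\<close>-fold zero. On the branch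
    \<open>W\<close> it is \<open>2 * t\<close>, which gave the nonvanishing above.\<close>
  moreover have "fps_X ^ m dvd fps_of_poly P - fps_of_poly (Q * k) * W"
  proof (rule fps_dvd_mult_unit_cancel[OF _ D0])
    have "fps_X ^ m dvd (\<Prod>i<m. fps_of_poly (vertex_poly t s i) + - W)"
      by (rule fps_X_power_dvd_prod) (use W(2) in \<open>simp add: vertex_poly_def\<close>)
    thus "fps_X ^ m dvd (fps_of_poly P - fps_of_poly (Q * k) * W) * D"
      using prod[OF Wm] by simp
  qed
  ultimately show ?thesis using PQ left unfolding k_def by blast
qed

text \<open>At infinity \<open>x\<close> has a double pole and \<open>w\<close> a simple one. After
  the multiplication by \<open>(\<gamma> - x) ^ (n div 2)\<close> the pole at infinity has order at
  most \<open>n\<close> for even \<open>n\<close> and \<open>n - 1\<close> for odd \<open>n\<close>.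
  With \<open>F\<close> for \<open>(\<gamma> - x) w\<close> and \<open>w\<close> respectively, this
  gives the two degree bounds.\<close>

definition pade_vanishing :: "nat \<Rightarrow> real fps \<Rightarrow> bool" where
  "pade_vanishing n F \<longleftrightarrow> (\<exists>p q. (p \<noteq> 0 \<or> q \<noteq> 0) \<and> degree p \<le> n div 2 \<and> degree q \<le> (n - 3) div 2 \<and>
     fps_X ^ n dvd fps_of_poly p - fps_of_poly q * F)"

text \<open>If the last chord is the first one, \<open>P + Q w\<close> vanishes at both \<open>(x, w)\<close> and \<open>(x, - w)\<close>, so \<open>x - x\<^sub>0\<close> can be divided out.\<close>

lemma pade_vanishing_if_closed:
  assumes "chain f g t s m" "m \<ge> 3" "degree g \<le> 1"
    and W: "W * W * fps_of_poly g = fps_of_poly f" "fps_nth W 0 = t"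
    and "t \<noteq> 0" "poly g 0 \<noteq> 0"
    and closed: "chord_x t s m = chord_x t s 0" "chord_w t s m = chord_w t s 0"
    and "chord_w t s 0 \<noteq> 0" "poly g (chord_x t s 0) \<noteq> 0"
  shows "pade_vanishing m (fps_of_poly (parity_factor g m) * W)"
proof -
  define k where "k = parity_factor g m"
  define x where "x = chord_x t s 0"
  obtain P Q where PQ: "degree P \<le> m div 2 + 1" "degree Q \<le> (m - 1) div 2" "P \<noteq> 0 \<or> Q \<noteq> 0"
    "poly P x + poly (Q * k) x * chord_w t s 0 = 0"
    "poly P x - poly (Q * k) x * chord_w t s 0 = 0"
    "fps_X ^ m dvd fps_of_poly P - fps_of_poly (Q * k) * W"
    using chain_function_both_ends[OF assms(1) _ assms(3-7)] assms(2) closed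
    unfolding k_def x_def by auto
  have "poly k x \<noteq> 0" using assms(11) by (simp add: k_def x_def parity_factor_def)
  with PQ(4,5) assms(10) have "poly P x = 0" "poly Q x = 0" by auto
  then obtain p q where pq: "P = [:-x, 1:] * p" "Q = [:-x, 1:] * q"
    unfolding poly_eq_0_iff_dvd by (elim dvdE)
  have x: "x \<noteq> 0" using assms(1,6) by (simp add: x_def chord_x_def param_x_def chain_def)
  have "degree p \<le> m div 2"
  proof (cases "p = 0")
    case False
    hence "degree P = Suc (degree p)" unfolding pq by (subst degree_mult_eq) auto
    thus ?thesis using PQ(1) by simp
  qed simp
  moreover have "degree q \<le> (m - 3) div 2"
  proof (cases "q = 0")
    case False
    hence "degree Q = Suc (degree q)" unfolding pq by (subst degree_mult_eq) auto
    thus ?thesis using PQ(2) assms(2) by linarith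
  qed simp
  moreover have "fps_X ^ m dvd fps_of_poly p - fps_of_poly q * (fps_of_poly k * W)"
  proof (rule fps_dvd_mult_unit_cancel)
    show "fps_X ^ m dvd (fps_of_poly p - fps_of_poly q * (fps_of_poly k * W)) * fps_of_poly [:-x, 1:]"
      using PQ(6) unfolding pq fps_of_poly_mult by (simp add: algebra_simps)
  qed (use x in simp)
  moreover have "p \<noteq> 0 \<or> q \<noteq> 0" using PQ(3) by (auto simp: pq)
  ultimately show ?thesis unfolding k_def pade_vanishing_def by blast
qed

text \<open>
  Multiplying \<open>P + Q w\<close> by \<open>p - q w\<close> gives \<open>x\<^sup>m\<close> times a function with at most a double pole at
  infinity, that is, a polynomial in \<open>x\<close> of degree at most 1; it vanishes at both end chords.
\<close>

lemma closed_if_pade_vanishing: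
  assumes "chain f g t s m" "m \<ge> 3" "degree g = 1" "degree f = 2"
    and W: "W * W * fps_of_poly g = fps_of_poly f" "fps_nth W 0 = t"
    and "t \<noteq> 0" "poly g 0 \<noteq> 0"
    and curve: "\<And>i. (chord_w t s i)\<^sup>2 * poly g (chord_x t s i) = poly f (chord_x t s i)"
    and "pade_vanishing m (fps_of_poly (parity_factor g m) * W)"
  shows "chord_x t s m = chord_x t s 0"
proof -
  define k where "k = parity_factor g m"
  define k' where "k' = parity_factor g (Suc m)"
  have kk: "k * k' = g" unfolding k_def k'_def by (rule parity_factor_mult_Suc)
  have deg_k: "degree k = (if even m then 1 else 0)" "degree k' = (if even m then 0 else 1)"
    using assms(3) by (auto simp: k_def k'_def parity_factor_def)
  have g0: "g \<noteq> 0" and f0: "f \<noteq> 0" using assms(3,4) by auto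
  hence k0: "k \<noteq> 0" "k' \<noteq> 0" using kk by auto
  let ?F = "fps_of_poly :: real poly \<Rightarrow> real fps"
  obtain p q where pq: "p \<noteq> 0 \<or> q \<noteq> 0" "degree p \<le> m div 2" "degree q \<le> (m - 3) div 2"
     "fps_X ^ m dvd ?F p - ?F q * (?F k * W)"
    using assms(10) unfolding k_def pade_vanishing_def by blast
  obtain P Q where PQ: "degree P \<le> m div 2 + 1" "degree Q \<le> (m - 1) div 2" "P \<noteq> 0 \<or> Q \<noteq> 0"
    and right: "poly P (chord_x t s m) = - poly (Q * k) (chord_x t s m) * chord_w t s m"
    and left: "poly P (chord_x t s 0) = poly (Q * k) (chord_x t s 0) * chord_w t s 0"
    and PQ_dvd: "fps_X ^ m dvd ?F P - ?F (Q * k) * W"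
    using chain_function_both_ends[OF assms(1) _ _ assms(5-8)] assms(2,3)
    unfolding k_def by (auto simp: eq_neg_iff_add_eq_0)
  \<comment> \<open>\<open>S + R g w\<close> is \<open>k' (P + Q k w) (p - q k w)\<close> with
    \<open>w^2 g\<close> replaced by \<open>f\<close>.\<close>
  define S where "S = k' * P * p - k * f * Q * q"
  define R where "R = Q * p - P * q"
  have fS: "?F S + ?F R * (?F g * W) = ?F k' * (?F P + ?F (Q * k) * W) * (?F p - ?F q * (?F k * W))"
    and fS': "?F S - ?F R * (?F g * W) = ?F k' * (?F P - ?F (Q * k) * W) * (?F p + ?F q * (?F k * W))"
  proof -
    have *: "?F S = ?F k' * ?F P * ?F p - ?F k * (W * W * (?F k * ?F k')) * ?F Q * ?F q"
      unfolding S_def fps_of_poly_mult[symmetric] kk W(1)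
      unfolding fps_of_poly_mult fps_of_poly_diff W(1)[unfolded kk[symmetric], symmetric] by (simp add: mult_ac)
    show "?F S + ?F R * (?F g * W) = ?F k' * (?F P + ?F (Q * k) * W) * (?F p - ?F q * (?F k * W))"
      "?F S - ?F R * (?F g * W) = ?F k' * (?F P - ?F (Q * k) * W) * (?F p + ?F q * (?F k * W))"
      unfolding * R_def kk[symmetric] fps_of_poly_mult fps_of_poly_diff by (simp_all add: algebra_simps)
  qed
  have d1: "fps_X ^ m dvd ?F S + ?F R * (?F g * W)"
    unfolding fS using pq(4) by simp
  have d2: "fps_X ^ m dvd ?F S - ?F R * (?F g * W)"
    unfolding fS' using PQ_dvd by (simp add: mult.assoc)
  have "fps_X ^ m dvd ?F S * 2"
    using dvd_add[OF d1 d2] by (simp add: mult_2_right)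
  hence S_dvd: "fps_X ^ m dvd ?F S"
    by (rule fps_dvd_mult_unit_cancel) simp
  have "fps_X ^ m dvd ?F R * (?F g * W) * 2"
    using dvd_diff[OF d1 d2] by (simp add: mult_2_right)
  hence "fps_X ^ m dvd ?F R * (?F g * W * 2)" by (simp only: mult.assoc)
  hence R_dvd: "fps_X ^ m dvd ?F R"
    by (rule fps_dvd_mult_unit_cancel) (use W(2) assms(7,8) in \<open>simp add: poly_0_coeff_0\<close>)
  \<comment> \<open>In both products the degree bounds add up to \<open>m - 1\<close>, so
    divisibility by the \<open>m\<close>-th power of \<open>x\<close> leaves only
    \<open>R = 0\<close>: the product has no part with \<open>w\<close>.\<close>
  have "degree R < m"
    unfolding R_def
  proof (rule degree_diff_less)
    show "degree (Q * p) < m"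
      using degree_mult_le[of Q p] PQ(2) pq(2) assms(2) by linarith
    show "degree (P * q) < m"
      using degree_mult_le[of P q] PQ(1) pq(3) assms(2) by linarith
  qed
  hence R: "Q * p = P * q"
    using R_dvd unfolding fps_X_power_dvd_iff_nth R_def[symmetric]
    by (metis R_def coeff_eq_0 eq_iff_diff_eq_0 fps_of_poly_nth not_less_iff_gr_or_eq order_less_trans poly_eqI coeff_0)
  \<comment> \<open>\<open>k\<close> times this polynomial is
    \<open>g * p\<^sup>2 - f * (k * q)\<^sup>2\<close>. Its terms have degrees of different parity
    and cannot cancel.\<close>
  have norm: "k' * p\<^sup>2 - k * f * q\<^sup>2 \<noteq> 0"
  proof
    assume "k' * p\<^sup>2 - k * f * q\<^sup>2 = 0"
    hence "k * (k' * p\<^sup>2) = k * (k * f * q\<^sup>2)" by simp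
    hence eq: "g * p\<^sup>2 = f * (k * q)\<^sup>2"
      by (simp add: kk[symmetric] power2_eq_square mult_ac)
    have "p \<noteq> 0" "q \<noteq> 0" using eq pq(1) g0 f0 k0 by auto
    hence "1 + 2 * degree p = 2 + 2 * degree (k * q)"
      using arg_cong[OF eq, of degree] g0 f0 k0 assms(3,4)
      by (simp add: degree_mult_eq degree_power_eq power2_eq_square)
    thus False by presburger
  qed
  have "S \<noteq> 0"
  proof
    assume "S = 0"
    hence S0: "k' * P * p = k * f * Q * q" by (simp add: S_def)
    have "P * (k' * p\<^sup>2) = (k' * P * p) * p" by (simp add: power2_eq_square mult_ac)
    also have "\<dots> = k * f * q * (Q * p)" unfolding S0 by (simp only: mult_ac)
    also have "\<dots> = P * (k * f * q\<^sup>2)" by (simp add: R power2_eq_square mult_ac)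
    finally have "P * (k' * p\<^sup>2 - k * f * q\<^sup>2) = 0" by (simp add: algebra_simps)
    hence "P = 0" using norm by simp
    have "Q * (k' * p\<^sup>2) = k' * p * (Q * p)" by (simp add: power2_eq_square mult_ac)
    also have "\<dots> = Q * (k * f * q\<^sup>2)"
      using S0 \<open>P = 0\<close> by (auto simp: R)
    finally have "Q * (k' * p\<^sup>2 - k * f * q\<^sup>2) = 0" by (simp add: algebra_simps)
    hence "Q = 0" using norm by simp
    with \<open>P = 0\<close> PQ(3) show False by simp
  qed
  have "monom 1 m dvd S"
    using S_dvd unfolding fps_X_power_dvd_iff_nth monom_1_dvd_iff' by simp
  then obtain S' where S': "S = monom 1 m * S'" by (elim dvdE)
  have "S' \<noteq> 0" using \<open>S \<noteq> 0\<close> S' by auto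
  have "degree S \<le> m + 1"
    unfolding S_def
  proof (rule degree_diff_le)
    have "degree (k' * P * p) \<le> degree k' + degree P + degree p"
      by (meson add_le_mono degree_mult_le le_refl order_trans)
    also have "\<dots> \<le> m + 1"
      using PQ(1) pq(2) deg_k by (cases "even m") (auto elim!: evenE oddE)
    finally show "degree (k' * P * p) \<le> m + 1" .
    have "degree (k * f * Q * q) \<le> degree k + degree f + degree Q + degree q"
      by (meson add_le_mono degree_mult_le le_refl order_trans)
    also have "\<dots> \<le> m + 1"
      using PQ(2) pq(3) deg_k assms(2,4) by (cases "even m"; simp; presburger)
    finally show "degree (k * f * Q * q) \<le> m + 1" .
  qed
  moreover have "degree S = m + degree S'"
    unfolding S' using \<open>S' \<noteq> 0\<close> by (subst degree_mult_eq) (auto simp: degree_monom_eq)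
  ultimately have deg_S': "degree S' \<le> 1" by simp
  \<comment> \<open>The sign \<open>e\<close> is the orientation in which the function vanishes at
    the chord: 1 for the first chord, reversed, and -1 for the last. \<open>S\<close> is free of
    \<open>w\<close>, so only \<open>e * e\<close> matters.\<close>
  have root: "poly S' (chord_x t s i) = 0"
    if "poly P (chord_x t s i) = e * poly (Q * k) (chord_x t s i) * chord_w t s i" "e * e = 1" "i \<le> m" for i e
  proof -
    let ?x = "chord_x t s i" and ?w = "chord_w t s i"
    let ?p = "poly p ?x" and ?q = "poly q ?x" and ?P = "poly P ?x" and ?Q = "poly Q ?x"
      and ?k = "poly k ?x" and ?k' = "poly k' ?x"
    have P: "?P = e * ?Q * ?k * ?w" using that by simp
    have f: "poly f ?x = ?w\<^sup>2 * (?k * ?k')" using curve[of i] by (simp flip: kk)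
    have "?Q * ?p = ?P * ?q" using arg_cong[OF R, of "\<lambda>p. poly p ?x"] by simp
    hence 0: "?Q * (?p - e * ?k * ?w * ?q) = 0" unfolding P by (simp add: algebra_simps)
    have "poly S ?x = ?k' * (e * ?Q * ?k * ?w) * ?p - (e * e) * ?k * (?w\<^sup>2 * (?k * ?k')) * ?Q * ?q"
      unfolding S_def by (simp add: P f that(2))
    also have "\<dots> = e * ?k' * ?k * ?w * (?Q * (?p - e * ?k * ?w * ?q))"
      by (simp add: algebra_simps power2_eq_square)
    finally have "poly S ?x = 0" by (simp only: 0 mult_zero_right)
    moreover have "?x \<noteq> 0" using assms(1,7) that(3) by (simp add: chord_x_def param_x_def chain_def)
    ultimately show ?thesis unfolding S' by (simp add: poly_monom)
  qed
  have "poly S' (chord_x t s m) = 0" using root[of m "-1"] right by simp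
  moreover have "poly S' (chord_x t s 0) = 0" using root[of 0 1] left by simp
  ultimately have "{chord_x t s m, chord_x t s 0} \<subseteq> {x. poly S' x = 0}" by simp
  hence "card {chord_x t s m, chord_x t s 0} \<le> 1"
    using card_poly_roots_bound[OF \<open>S' \<noteq> 0\<close>] poly_roots_finite[OF \<open>S' \<noteq> 0\<close>] deg_S' card_mono order_trans
    by metis
  thus ?thesis by (cases "chord_x t s m = chord_x t s 0") auto
qed

section \<open>Poncelet sequences\<close>

text \<open>
  The chord joining the points with parameters \<open>s\<close> and \<open>u\<close> touches the caustic iff \<open>u\<close> is a root of the
  quadratic polynomial with the three coefficients below (lemma \<open>tangent_chord_iff\<close>).
\<close>

definition polar_lead :: "real \<Rightarrow> real \<Rightarrow> real \<Rightarrow> real \<Rightarrow> real" where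
  "polar_lead a b \<gamma> s = a * b - \<gamma> * (2 * sqrt (a * b) * s + (b - a))"

definition polar_mid :: "real \<Rightarrow> real \<Rightarrow> real \<Rightarrow> real \<Rightarrow> real" where
  "polar_mid a b \<gamma> s =
     - 2 * (a * b) * s - \<gamma> * (2 * sqrt (a * b) * s\<^sup>2 - 2 * sqrt (a * b) + 2 * (b - a) * s)"

definition polar_const :: "real \<Rightarrow> real \<Rightarrow> real \<Rightarrow> real \<Rightarrow> real" where
  "polar_const a b \<gamma> s = a * b * s\<^sup>2 - \<gamma> * ((b - a) * s\<^sup>2 - 2 * sqrt (a * b) * s)"

definition chord_touches :: "real \<Rightarrow> real \<Rightarrow> real \<Rightarrow> real \<Rightarrow> real \<Rightarrow> bool" where
  "chord_touches a b \<gamma> s u \<longleftrightarrow>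
     polar_lead a b \<gamma> s * u\<^sup>2 + polar_mid a b \<gamma> s * u + polar_const a b \<gamma> s = 0"

lemma chord_touches_iff:
  assumes "a > 0" "b > 0"
  shows "chord_touches a b \<gamma> s u \<longleftrightarrow>
    a * b * (s - u)\<^sup>2 = \<gamma> * (s + u) * (2 * sqrt (a * b) * (s * u - 1) + (b - a) * (s + u))"
  unfolding chord_touches_def polar_lead_def polar_mid_def polar_const_def
  by (simp add: algebra_simps power2_eq_square)

lemma chord_touches_commute:
  assumes "a > 0" "b > 0"
  shows "chord_touches a b \<gamma> s u \<longleftrightarrow> chord_touches a b \<gamma> u s"
  unfolding chord_touches_iff[OF assms] by (simp add: power2_commute add.commute mult.commute)

text \<open>\<open>u\<close> and \<open>v\<close> are the two roots with multiplicity; \<open>u = v\<close> at a vertex that lies on the caustic.\<close>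

definition poncelet_step :: "real \<Rightarrow> real \<Rightarrow> real \<Rightarrow> real \<Rightarrow> real \<Rightarrow> real \<Rightarrow> bool" where
  "poncelet_step a b \<gamma> u s v \<longleftrightarrow> chord_touches a b \<gamma> s u \<and>
     polar_lead a b \<gamma> s * (u + v) = - polar_mid a b \<gamma> s \<and>
     polar_lead a b \<gamma> s * (u * v) = polar_const a b \<gamma> s"

text \<open>The value of the polar quadratic at \<open>u = - s\<close>. Factored over the roots
  \<open>u\<close> and \<open>v\<close> it is
  \<open>polar_lead a b \<gamma> s * (s + u) * (s + v)\<close>, which contains the denominators of
  both chord coordinates.\<close>

lemma polar_eval_neg:
  assumes "a > 0" "b > 0"
  shows "polar_lead a b \<gamma> s * s\<^sup>2 - polar_mid a b \<gamma> s * s + polar_const a b \<gamma> s = 4 * (a * b) * s\<^sup>2"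
  unfolding polar_lead_def polar_mid_def polar_const_def
  by (simp add: algebra_simps power2_eq_square)

lemma sum_nonzero_if_chord_touches:
  assumes "a > 0" "b > 0" "chord_touches a b \<gamma> s u" "s \<noteq> 0"
  shows "s + u \<noteq> 0"
proof
  assume "s + u = 0"
  hence "u = - s" by simp
  thus False using assms unfolding chord_touches_iff[OF assms(1,2)] by auto
qed

lemma param_curve:
  assumes "a > 0" "b > 0" "chord_touches a b \<gamma> u s" "u + s \<noteq> 0"
  defines "x \<equiv> param_x (sqrt (a * b)) u s" and "w \<equiv> param_w (sqrt (a * b)) u s"
  shows "w\<^sup>2 * (\<gamma> - x) = \<gamma> * (a - x) * (b + x)"
proof -
  define t where "t = sqrt (a * b)"
  have t: "t * t = a * b" using assms by (simp add: t_def)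
  define D where "D = u + s"
  have D: "D \<noteq> 0" "x * D = - 2 * t" "w * D = t * (u - s)"
    using assms(4) by (auto simp: D_def x_def w_def param_x_def param_w_def t_def[symmetric])
  have touch: "t * t * (u - s)\<^sup>2 = \<gamma> * D * (2 * t * (u * s - 1) + (b - a) * D)"
    using assms(3) unfolding chord_touches_iff[OF assms(1,2)] t_def[symmetric] t D_def .
  have us: "4 * (u * s) = D\<^sup>2 - (u - s)\<^sup>2" by (simp add: D_def power2_eq_square algebra_simps)
  have "D ^ 3 * (w\<^sup>2 * (\<gamma> - x)) = (w * D)\<^sup>2 * (\<gamma> * D - x * D)"
    by (simp add: power2_eq_square power3_eq_cube algebra_simps)
  also have "\<dots> = \<gamma> * D * (t * t) * (u - s)\<^sup>2 + 2 * t * (t * t * (u - s)\<^sup>2)"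
    unfolding D by (simp add: power2_eq_square algebra_simps)
  \<comment> \<open>Inserting tangency in the second term only pulls out
    \<open>\<gamma> * D\<close>. The square \<open>(u - s)\<^sup>2\<close> left in the first term
    then cancels against \<open>4 * (u * s) = D\<^sup>2 - (u - s)\<^sup>2\<close>.\<close>
  also have "\<dots> = \<gamma> * D * ((t * t) * (u - s)\<^sup>2 + (t * t) * (4 * (u * s)) - 4 * (t * t) + 2 * t * (b - a) * D)"
  proof -
    have "2 * t * (t * t * (u - s)\<^sup>2) = 2 * t * (\<gamma> * D * (2 * t * (u * s - 1) + (b - a) * D))"
      by (simp only: touch)
    thus ?thesis by (simp add: algebra_simps)
  qed
  also have "\<dots> = \<gamma> * D * (a * D + 2 * t) * (b * D - 2 * t)"
    unfolding us using t by (simp add: power2_eq_square algebra_simps)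
  also have "\<dots> = \<gamma> * D * (a * D - x * D) * (b * D + x * D)" by (simp add: D)
  also have "\<dots> = D ^ 3 * (\<gamma> * (a - x) * (b + x))"
    by (simp add: power3_eq_cube algebra_simps)
  finally show ?thesis using D(1) by simp
qed

text \<open>\<open>param_x\<close> is a multiple of the reciprocal of a parameter sum. The product
  of the two coordinates therefore comes from \<open>polar_eval_neg\<close>, and their sum from the
  sum of the two roots.\<close>

lemma poncelet_step_param_x:
  assumes ab: "a > 0" "b > 0" and step: "poncelet_step a b \<gamma> u s v" and "s \<noteq> 0"
  defines "x \<equiv> param_x (sqrt (a * b)) u s" and "x' \<equiv> param_x (sqrt (a * b)) s v"
  shows "u + s \<noteq> 0" "s + v \<noteq> 0" "polar_lead a b \<gamma> s \<noteq> 0"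
    "s\<^sup>2 * (x * x') = polar_lead a b \<gamma> s"
    "s\<^sup>2 * (x + x') = \<gamma> * s\<^sup>2 - 2 * sqrt (a * b) * s + \<gamma>"
proof -
  define t where "t = sqrt (a * b)"
  have t: "t * t = a * b" "t > 0" using assms by (auto simp: t_def)
  define A where "A = polar_lead a b \<gamma> s"
  have vieta: "A * (u + v) = - polar_mid a b \<gamma> s" "A * (u * v) = polar_const a b \<gamma> s"
    using step by (auto simp: poncelet_step_def A_def)
  have "A * ((u + s) * (s + v)) = A * s\<^sup>2 + A * (u + v) * s + A * (u * v)"
    by (simp add: algebra_simps power2_eq_square)
  also have "\<dots> = 4 * (a * b) * s\<^sup>2"
    using polar_eval_neg[OF ab, of \<gamma> s] unfolding vieta by (simp add: A_def)
  finally have prod: "A * ((u + s) * (s + v)) = 4 * (t * t) * s\<^sup>2" by (simp add: t)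
  hence "A * ((u + s) * (s + v)) \<noteq> 0" using t assms by simp
  thus nz: "u + s \<noteq> 0" "s + v \<noteq> 0" "polar_lead a b \<gamma> s \<noteq> 0" by (auto simp: A_def)
  have x: "x * (u + s) = - 2 * t" "x' * (s + v) = - 2 * t"
    using nz by (auto simp: x_def x'_def param_x_def t_def)
  let ?N = "(u + s) * (s + v)"
  have N: "?N \<noteq> 0" using nz by simp
  have "?N * (s\<^sup>2 * (x * x')) = s\<^sup>2 * ((x * (u + s)) * (x' * (s + v)))" by (simp add: mult_ac)
  also have "\<dots> = ?N * A" unfolding x using prod by (simp add: algebra_simps)
  finally show "s\<^sup>2 * (x * x') = polar_lead a b \<gamma> s" using N by (simp add: A_def)
  have "2 * t * ?N * (s\<^sup>2 * (x + x')) = 2 * t * s\<^sup>2 * ((x * (u + s)) * (s + v) + (x' * (s + v)) * (u + s))"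
    by (simp add: algebra_simps)
  also have "\<dots> = - (4 * (t * t) * s\<^sup>2) * (u + v + 2 * s)"
    unfolding x by (simp add: algebra_simps)
  also have "\<dots> = - ?N * (A * (u + v) + 2 * s * A)"
    unfolding prod[symmetric] by (simp add: algebra_simps)
  also have "\<dots> = 2 * t * ?N * (\<gamma> * s\<^sup>2 - 2 * t * s + \<gamma>)"
  proof -
    have "- (A * (u + v) + 2 * s * A) = 2 * t * (\<gamma> * s\<^sup>2 - 2 * t * s + \<gamma>)"
    proof -
      have mid: "polar_mid a b \<gamma> s = - 2 * (t * t) * s - \<gamma> * (2 * t * s\<^sup>2 - 2 * t + 2 * (b - a) * s)"
        unfolding polar_mid_def t_def[symmetric] t(1) ..
      have lead: "A = t * t - \<gamma> * (2 * t * s + (b - a))"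
        unfolding A_def polar_lead_def t_def[symmetric] t(1) ..
      show ?thesis unfolding vieta unfolding mid lead by (simp add: algebra_simps power2_eq_square)
    qed
    thus ?thesis by (metis mult.assoc mult.commute mult_minus_left mult_minus_right)
  qed
  finally show "s\<^sup>2 * (x + x') = \<gamma> * s\<^sup>2 - 2 * sqrt (a * b) * s + \<gamma>"
    using N t(2) unfolding t_def[symmetric] by simp
qed

text \<open>A comparison of coefficients: the constant one vanishes because
  \<open>sqrt (a * b)\<close> squares to \<open>a * b\<close>, and the two middle ones are the
  product and the sum of the chord coordinates.\<close>

lemma vertex_poly_identity:
  assumes ab: "a > 0" "b > 0" and step: "poncelet_step a b \<gamma> u s v" and "s \<noteq> 0"
  shows "[:sqrt (a * b), s:] * [:sqrt (a * b), s:] * [:\<gamma>, -1:] - Polynomial.smult \<gamma> ([:a, -1:] * [:b, 1:]) =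
    Polynomial.smult (- s\<^sup>2) ([:0, 1:] * [:- param_x (sqrt (a * b)) u s, 1:] * [:- param_x (sqrt (a * b)) s v, 1:])"
proof -
  define t where "t = sqrt (a * b)"
  have t: "t * t = a * b" "t > 0" using assms by (auto simp: t_def)
  define x where "x = param_x t u s"
  define x' where "x' = param_x t s v"
  have 1: "s\<^sup>2 * (x * x') = a * b - \<gamma> * (2 * t * s + (b - a))"
    and 2: "s\<^sup>2 * (x + x') = \<gamma> * s\<^sup>2 - 2 * t * s + \<gamma>"
    using poncelet_step_param_x(4,5)[OF assms] by (auto simp: x_def x'_def t_def polar_lead_def)
  have lhs: "[:t, s:] * [:t, s:] * [:\<gamma>, -1:] - Polynomial.smult \<gamma> ([:a, -1:] * [:b, 1:]) =
    [:t * t * \<gamma> - \<gamma> * (a * b), 2 * t * s * \<gamma> - t * t - \<gamma> * (a - b), s\<^sup>2 * \<gamma> - 2 * t * s + \<gamma>, - s\<^sup>2:]"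
    by (simp add: algebra_simps power2_eq_square)
  have rhs: "Polynomial.smult (- s\<^sup>2) ([:0, 1:] * [:- x, 1:] * [:- x', 1:]) =
    [:0, - (s\<^sup>2 * (x * x')), s\<^sup>2 * (x + x'), - s\<^sup>2:]"
    by (simp add: algebra_simps)
  show ?thesis
    unfolding t_def[symmetric] x_def[symmetric] x'_def[symmetric] lhs rhs 1 2
    by (simp add: t algebra_simps)
qed

text \<open>
  Equality of the \<open>x\<close>-coordinates leaves open that the ends of the chord are exchanged. If this occurs
  once, it occurs at every step, and then one line would touch the caustic at both ends of the chord.
\<close>

lemma not_both_ends_double:
  assumes ab: "a > 0" "b > 0" and \<gamma>: "\<gamma> \<notin> {- b, 0, a}"
    and "poncelet_step a b \<gamma> u s u" "poncelet_step a b \<gamma> s u s" and "s \<noteq> 0" "u \<noteq> 0" "s \<noteq> u"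
  shows False
proof -
  define t where "t = sqrt (a * b)"
  have t: "t > 0" using ab by (simp add: t_def)
  define x where "x = param_x t u s"
  have x': "param_x t s u = x" by (simp add: x_def param_x_def add.commute)
  have nz: "u + s \<noteq> 0" using poncelet_step_param_x(1)[OF ab assms(4,6)] .
  have "s\<^sup>2 * (x + x) = \<gamma> * s\<^sup>2 - 2 * t * s + \<gamma>"
    using poncelet_step_param_x(5)[OF ab assms(4,6)] by (simp add: x' x_def t_def[symmetric])
  moreover have "u\<^sup>2 * (x + x) = \<gamma> * u\<^sup>2 - 2 * t * u + \<gamma>"
    using poncelet_step_param_x(5)[OF ab assms(5,7)] x' by (simp add: x_def t_def[symmetric])
  ultimately have "(s - u) * ((s + u) * (2 * x - \<gamma>) + 2 * t) = 0"
    by (simp add: algebra_simps power2_eq_square)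
  hence "(s + u) * (2 * x - \<gamma>) + 2 * t = 0" using assms(8) by simp
  moreover have "x * (u + s) = - 2 * t" using nz by (simp add: x_def param_x_def)
  moreover have "(s + u) * (x - \<gamma>) = ((s + u) * (2 * x - \<gamma>) + 2 * t) - (x * (u + s) + 2 * t)"
    by (simp add: algebra_simps)
  ultimately have "(s + u) * (x - \<gamma>) = 0" by simp
  hence "x = \<gamma>" using nz by (simp add: add.commute)
  moreover have "chord_touches a b \<gamma> u s"
    using assms(4) chord_touches_commute[OF ab] by (auto simp: poncelet_step_def)
  \<comment> \<open>At \<open>x = \<gamma>\<close> the left side of the cubic equation vanishes, so
    the right side does too; this forces an excluded value of \<open>\<gamma>\<close>.\<close>
  ultimately have "\<gamma> * (a - \<gamma>) * (b + \<gamma>) = 0"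
    using param_curve[OF ab _ nz, of \<gamma>] by (simp add: x_def t_def)
  thus False using \<gamma> by (auto simp: add_eq_0_iff)
qed

definition poncelet_sequence :: "real \<Rightarrow> real \<Rightarrow> real \<Rightarrow> (int \<Rightarrow> real) \<Rightarrow> bool" where
  "poncelet_sequence a b \<gamma> s \<longleftrightarrow>
     (\<forall>k. s k \<noteq> 0 \<and> s k \<noteq> s (k + 1) \<and> poncelet_step a b \<gamma> (s (k - 1)) (s k) (s (k + 1)))"

text \<open>The \<open>x\<close>-coordinate determines the sum of the parameters and then
  \<open>w^2\<close> the square of their difference. Only the sign of \<open>w\<close> knows the
  order.\<close>

lemma same_pair_if_param_eq:
  assumes "t > 0" "(u :: real) + v \<noteq> 0" "u' + v' \<noteq> 0" "param_x t u v = param_x t u' v'"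
    and "(param_w t u v)\<^sup>2 = (param_w t u' v')\<^sup>2"
  shows "u' = u \<and> v' = v \<or> u' = v \<and> v' = u"
proof -
  have sum: "u + v = u' + v'" using assms(1-4) by (simp add: param_x_def field_simps)
  have "(u - v)\<^sup>2 = (u' - v')\<^sup>2"
    using assms(1-3,5) unfolding param_w_def sum by (simp add: power_divide power_mult_distrib)
  hence "u - v = u' - v' \<or> u - v = - (u' - v')" by (simp add: power2_eq_iff)
  thus ?thesis using sum by auto
qed

text \<open>The right-hand side does not depend on \<open>s\<close>, so Poncelet's porism is
  included. For the direction towards periodicity the chain argument is applied from every starting
  index \<open>j\<close>, since a single start yields the chord only up to orientation.\<close>

theorem poncelet_sequence_periodic_iff:
  assumes ab: "a > 0" "b > 0" and \<gamma>: "\<gamma> \<notin> {- b, 0, a}" and "n \<ge> 3"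
    and s: "poncelet_sequence a b \<gamma> s"
    and W: "W * W * fps_of_poly [:\<gamma>, -1:] = fps_of_poly (Polynomial.smult \<gamma> ([:a, -1:] * [:b, 1:]))"
      "fps_nth W 0 = sqrt (a * b)"
  shows "(\<forall>k. s (k + int n) = s k) \<longleftrightarrow> pade_vanishing n (fps_of_poly (parity_factor [:\<gamma>, -1:] n) * W)"
proof -
  define t where "t = sqrt (a * b)"
  have t: "t > 0" using ab by (simp add: t_def)
  define g where "g = [:\<gamma>, -1:]"
  define f where "f = Polynomial.smult \<gamma> ([:a, -1:] * [:b, 1:])"
  define \<sigma> where "\<sigma> j = (\<lambda>i. s (j + int i))" for j
  have step: "poncelet_step a b \<gamma> (s k) (s (k + 1)) (s (k + 2))"
    and nz: "s k \<noteq> 0" "s k \<noteq> s (k + 1)" for k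
    using s[unfolded poncelet_sequence_def, rule_format, of k]
      s[unfolded poncelet_sequence_def, rule_format, of "k + 1"] by (auto simp: algebra_simps)
  have sum_nz: "s k + s (k + 1) \<noteq> 0" for k
    using poncelet_step_param_x(1)[OF ab step nz(1)] .
  have chord: "chord_x t (\<sigma> j) i = param_x t (s (j + int i)) (s (j + int i + 1))"
     "chord_w t (\<sigma> j) i = param_w t (s (j + int i)) (s (j + int i + 1))" for i j
    by (simp_all add: chord_x_def chord_w_def \<sigma>_def algebra_simps)
  have chain: "chain f g t (\<sigma> j) m" for j m
    unfolding chain_def
  proof (intro conjI allI impI)
    show "\<sigma> j k + \<sigma> j (Suc k) \<noteq> 0" for k
      using sum_nz[of "j + int k"] by (simp add: \<sigma>_def algebra_simps)
    show "vertex_poly t (\<sigma> j) k * vertex_poly t (\<sigma> j) k * g - f =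
      Polynomial.smult (- (\<sigma> j (Suc k))\<^sup>2) ([:0, 1:] * [:- chord_x t (\<sigma> j) k, 1:] * [:- chord_x t (\<sigma> j) (Suc k), 1:])" for k
    proof -
      have idx: "j + int (Suc k) = j + int k + 1" "j + int k + 1 + 1 = j + int k + 2" by auto
      show ?thesis
        unfolding chord unfolding vertex_poly_def \<sigma>_def g_def f_def t_def idx
        by (rule vertex_poly_identity[OF ab step nz(1)])
    qed
  qed
  have curve: "(chord_w t (\<sigma> j) i)\<^sup>2 * poly g (chord_x t (\<sigma> j) i) = poly f (chord_x t (\<sigma> j) i)" for i j
  proof -
    have "chord_touches a b \<gamma> (s (j + int i)) (s (j + int i + 1))"
      using step chord_touches_commute[OF ab] by (auto simp: poncelet_step_def)
    from param_curve[OF ab this sum_nz] show ?thesis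
      unfolding chord by (simp add: g_def f_def t_def algebra_simps)
  qed
  have poly_facts: "degree g = 1" "degree f = 2" "poly g 0 \<noteq> 0"
    using \<gamma> by (auto simp: g_def f_def)
  have poly_f: "poly f x = \<gamma> * (a - x) * (b + x)" for x
    unfolding f_def poly_smult poly_mult by simp
  note W' = W[folded g_def f_def t_def]
  show ?thesis unfolding g_def[symmetric]
  proof
    assume per: "\<forall>k. s (k + int n) = s k"
    have "chord_x t (\<sigma> 0) n = chord_x t (\<sigma> 0) 0" "chord_w t (\<sigma> 0) n = chord_w t (\<sigma> 0) 0"
      unfolding chord using spec[OF per, of 0] spec[OF per, of 1] by (simp_all add: add.commute)
    moreover have w: "chord_w t (\<sigma> 0) 0 \<noteq> 0"
      unfolding chord using t nz(2)[of 0] sum_nz[of 0] by (simp add: param_w_def)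
    moreover have "poly g (chord_x t (\<sigma> 0) 0) \<noteq> 0"
    proof
      assume "poly g (chord_x t (\<sigma> 0) 0) = 0"
      hence "chord_x t (\<sigma> 0) 0 = \<gamma>" "poly f (chord_x t (\<sigma> 0) 0) = 0"
        using curve[of 0 0] by (simp_all add: g_def)
      thus False using \<gamma> by (auto simp: poly_f add_eq_0_iff)
    qed
    ultimately show "pade_vanishing n (fps_of_poly (parity_factor g n) * W)"
      using pade_vanishing_if_closed[OF chain[of 0 n] assms(4) _ W'] poly_facts t by simp
  next
    assume pade: "pade_vanishing n (fps_of_poly (parity_factor g n) * W)"
    have pair: "s (j + int n) = s j \<and> s (j + int n + 1) = s (j + 1) \<or>
        s (j + int n) = s (j + 1) \<and> s (j + int n + 1) = s j" for j
    proof -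
      have "chord_x t (\<sigma> j) n = chord_x t (\<sigma> j) 0"
        using closed_if_pade_vanishing[OF chain[of j n] assms(4) poly_facts(1,2) W' _ poly_facts(3) curve pade] t
        by simp
      hence x: "param_x t (s j) (s (j + 1)) = param_x t (s (j + int n)) (s (j + int n + 1))"
        unfolding chord by simp
      have "poly g (chord_x t (\<sigma> j) 0) \<noteq> 0"
      proof
        assume "poly g (chord_x t (\<sigma> j) 0) = 0"
        hence "chord_x t (\<sigma> j) 0 = \<gamma>" "poly f (chord_x t (\<sigma> j) 0) = 0"
          using curve[of j 0] by (simp_all add: g_def)
        thus False using \<gamma> by (auto simp: poly_f add_eq_0_iff)
      qed
      hence "(param_w t (s j) (s (j + 1)))\<^sup>2 = (param_w t (s (j + int n)) (s (j + int n + 1)))\<^sup>2"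
        using curve[of j 0] curve[of j n] x unfolding chord by (simp add: mult_right_cancel) (metis mult_right_cancel)
      from same_pair_if_param_eq[OF t sum_nz sum_nz x this] show ?thesis .
    qed
    show "\<forall>k. s (k + int n) = s k"
    proof (intro allI, rule ccontr)
      fix k assume ne: "s (k + int n) \<noteq> s k"
      have 0: "s (k + int n) = s (k + 1)" "s (k + int n + 1) = s k" using pair[of k] ne by auto
      \<comment> \<open>The exchange propagates: without it at \<open>k + 1\<close>, the common
        vertex would give \<open>s (k + 1) = s k\<close>. Likewise at \<open>k + 2\<close>.\<close>
      have 1: "s (k + int n + 1) = s (k + 2)" "s (k + int n + 2) = s (k + 1)"
        using pair[of "k + 1"] 0 nz(2)[of k] by (auto simp: add_ac)
      have 2: "s (k + int n + 2) = s (k + 3)"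
        using pair[of "k + 2"] 0 1 nz(2)[of k] by (auto simp: add_ac)
      have "s (k + 2) = s k" "s (k + 3) = s (k + 1)" using 0 1 2 by auto
      thus False
        using not_both_ends_double[OF ab \<gamma>, of "s k" "s (k + 1)"] step[of k] step[of "k + 1"] nz[of k] nz(1)[of "k + 1"]
        by (simp add: add.assoc)
    qed
  qed
qed

section \<open>Tangency and reflection\<close>

lemma affine_hull_pair_eq:
  fixes P Q :: "real \<times> real"
  shows "affine hull {P, Q} = {P + c *\<^sub>R (Q - P) | c. True}"
proof -
  have "affine hull {P, Q} = {u *\<^sub>R P + v *\<^sub>R Q | u v. u + v = 1}"
    by (rule affine_hull_2)
  also have "\<dots> = {P + c *\<^sub>R (Q - P) | c. True}"
  proof (intro equalityI subsetI)
    fix X assume "X \<in> {u *\<^sub>R P + v *\<^sub>R Q | u v. u + v = 1}"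
    then obtain u v where uv: "X = u *\<^sub>R P + v *\<^sub>R Q" "u + v = 1" by blast
    hence "X = (1 - v) *\<^sub>R P + v *\<^sub>R Q" by (metis add_diff_cancel_right')
    hence "X = P + v *\<^sub>R (Q - P)" by (simp add: algebra_simps)
    thus "X \<in> {P + c *\<^sub>R (Q - P) | c. True}" by blast
  next
    fix X assume "X \<in> {P + c *\<^sub>R (Q - P) | c. True}"
    then obtain c where "X = P + c *\<^sub>R (Q - P)" by blast
    hence "X = (1 - c) *\<^sub>R P + c *\<^sub>R Q" by (simp add: algebra_simps)
    moreover have "(1 - c) + c = 1" by simp
    ultimately show "X \<in> {u *\<^sub>R P + v *\<^sub>R Q | u v. u + v = 1}" by blast
  qed
  finally show ?thesis .
qed

lemma affine_hull_pair_eq_line: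
  fixes p1 p2 q1 q2 u v w :: real
  assumes "(p1, p2) \<noteq> (q1, q2)" "u * p1 + v * p2 = w" "u * q1 + v * q2 = w" "u \<noteq> 0 \<or> v \<noteq> 0"
  shows "affine hull {(p1, p2), (q1, q2)} = {(x, y). u * x + v * y = w}"
  unfolding affine_hull_pair_eq
proof (intro equalityI subsetI)
  fix X assume "X \<in> {(p1, p2) + c *\<^sub>R ((q1, q2) - (p1, p2)) | c. True}"
  then obtain c where X: "X = (p1 + c * (q1 - p1), p2 + c * (q2 - p2))" by auto
  have "u * (p1 + c * (q1 - p1)) + v * (p2 + c * (q2 - p2)) =
    (u * p1 + v * p2) + c * ((u * q1 + v * q2) - (u * p1 + v * p2))"
    by (simp add: algebra_simps)
  thus "X \<in> {(x, y). u * x + v * y = w}" using assms by (simp add: X)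
next
  fix X assume "X \<in> {(x, y). u * x + v * y = w}"
  then obtain x y where X: "X = (x, y)" and xy: "u * x + v * y = w" by blast
  have 1: "u * (q1 - p1) = - (v * (q2 - p2))" and 2: "u * (x - p1) = - (v * (y - p2))"
    using assms xy by (simp_all add: algebra_simps)
  have "\<exists>c. x = p1 + c * (q1 - p1) \<and> y = p2 + c * (q2 - p2)"
  proof (cases "v = 0")
    case True
    hence "q1 = p1" "x = p1" "u \<noteq> 0" using 1 2 assms(4) by auto
    moreover have "q2 \<noteq> p2" using \<open>q1 = p1\<close> assms(1) by auto
    ultimately show ?thesis by (intro exI[of _ "(y - p2) / (q2 - p2)"]) simp
  next
    case False
    have "q1 \<noteq> p1"
    proof
      assume "q1 = p1"
      with 1 False have "q2 = p2" by simp
      with \<open>q1 = p1\<close> assms(1) show False by simp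
    qed
    define c where "c = (x - p1) / (q1 - p1)"
    have x: "x - p1 = c * (q1 - p1)" using \<open>q1 \<noteq> p1\<close> by (simp add: c_def)
    have "v * (y - p2) = - (c * (u * (q1 - p1)))" using 2 unfolding x by (simp add: mult.left_commute)
    hence "v * (y - p2) = v * (c * (q2 - p2))" unfolding 1 by (simp add: mult.left_commute)
    hence "y - p2 = c * (q2 - p2)" using False by simp
    with x show ?thesis by (intro exI[of _ c]) simp
  qed
  thus "X \<in> {(p1, p2) + c *\<^sub>R ((q1, q2) - (p1, p2)) | c. True}" by (auto simp: X)
qed

lemma mult_sq_eq_zero_swap:
  fixes A B x y :: real
  assumes "A \<noteq> 0" "B \<noteq> 0"
  shows "x\<^sup>2 / A + y\<^sup>2 / B = 0 \<longleftrightarrow> A * y\<^sup>2 + B * x\<^sup>2 = 0"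
  using assms by (simp add: field_simps)

text \<open>The equation of the dual conic: the line \<open>u x + v y = 1\<close> touches iff
  \<open>(a - \<gamma>) u^2 + (b + \<gamma>) v^2 = 1\<close>. Here it is homogenized in the line
  coordinates obtained from two points, which covers lines through the centre as well.\<close>

lemma tangent_to_conic_hull_iff:
  assumes nd: "\<gamma> \<noteq> a" "\<gamma> \<noteq> - b" and ne: "(p1, p2) \<noteq> (q1, q2)"
  shows "tangent_to_conic a b \<gamma> (affine hull {(p1, p2), (q1, q2)}) \<longleftrightarrow>
    (a - \<gamma>) * (q2 - p2)\<^sup>2 + (b + \<gamma>) * (q1 - p1)\<^sup>2 = (p1 * q2 - p2 * q1)\<^sup>2"
    (is "?L \<longleftrightarrow> ?R")
proof
  have nz: "a - \<gamma> \<noteq> 0" "b + \<gamma> \<noteq> 0" using nd by auto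
  assume ?L
  then consider x0 y0 where "(x0, y0) \<in> confocal_conic a b \<gamma>"
      "affine hull {(p1, p2), (q1, q2)} = conic_tangent a b \<gamma> (x0, y0)"
    | "conic_asymptote a b \<gamma> (affine hull {(p1, p2), (q1, q2)})"
    unfolding tangent_to_conic_def by auto
  thus ?R
  proof cases
    case 1
    define u where "u = x0 / (a - \<gamma>)"
    define v where "v = y0 / (b + \<gamma>)"
    have uv: "(a - \<gamma>) * u\<^sup>2 + (b + \<gamma>) * v\<^sup>2 = 1"
      using 1(1) nz by (simp add: u_def v_def confocal_conic_def power2_eq_square)
    have "(p1, p2) \<in> conic_tangent a b \<gamma> (x0, y0)" "(q1, q2) \<in> conic_tangent a b \<gamma> (x0, y0)"
      unfolding 1(2)[symmetric] by (auto intro: hull_inc)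
    hence on: "u * p1 + v * p2 = 1" "u * q1 + v * q2 = 1"
      by (auto simp: conic_tangent_def u_def v_def)
    let ?C = "p1 * q2 - p2 * q1"
    have "u * ?C = (u * p1 + v * p2) * q2 - (u * q1 + v * q2) * p2"
      "v * ?C = (u * q1 + v * q2) * p1 - (u * p1 + v * p2) * q1"
      by (simp_all add: algebra_simps)
    hence C: "u * ?C = q2 - p2" "v * ?C = p1 - q1" unfolding on by simp_all
    have "(a - \<gamma>) * (q2 - p2)\<^sup>2 + (b + \<gamma>) * (p1 - q1)\<^sup>2 = ((a - \<gamma>) * u\<^sup>2 + (b + \<gamma>) * v\<^sup>2) * ?C\<^sup>2"
      unfolding C[symmetric] by (simp only: power_mult_distrib distrib_right mult.assoc)
    thus ?thesis unfolding uv by (simp add: power2_commute[of p1])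
  next
    case 2
    then obtain v1 v2 where v: "v1\<^sup>2 / (a - \<gamma>) + v2\<^sup>2 / (b + \<gamma>) = 0"
      "affine hull {(p1, p2), (q1, q2)} = span {(v1, v2)}"
      unfolding conic_asymptote_def by auto
    have "(p1, p2) \<in> span {(v1, v2)}" "(q1, q2) \<in> span {(v1, v2)}"
      unfolding v(2)[symmetric] by (auto intro: hull_inc)
    then obtain c d where "p1 = c * v1" "p2 = c * v2" "q1 = d * v1" "q2 = d * v2"
      by (auto simp: span_singleton)
    moreover have "(a - \<gamma>) * v2\<^sup>2 + (b + \<gamma>) * v1\<^sup>2 = 0"
      using v(1) mult_sq_eq_zero_swap[OF nz] by simp
    moreover have "(a - \<gamma>) * (d * v2 - c * v2)\<^sup>2 + (b + \<gamma>) * (d * v1 - c * v1)\<^sup>2 =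
      (d - c)\<^sup>2 * ((a - \<gamma>) * v2\<^sup>2 + (b + \<gamma>) * v1\<^sup>2)"
      by (simp add: power2_eq_square algebra_simps)
    ultimately show ?thesis by simp
  qed
next
  have nz: "a - \<gamma> \<noteq> 0" "b + \<gamma> \<noteq> 0" using nd by auto
  assume R: ?R
  let ?C = "p1 * q2 - p2 * q1"
  show ?L
  proof (cases "?C = 0")
    case False
    define u where "u = (q2 - p2) / ?C"
    define v where "v = (p1 - q1) / ?C"
    have uv: "(a - \<gamma>) * u\<^sup>2 + (b + \<gamma>) * v\<^sup>2 = 1"
    proof -
      have "(a - \<gamma>) * u\<^sup>2 + (b + \<gamma>) * v\<^sup>2 = ((a - \<gamma>) * (q2 - p2)\<^sup>2 + (b + \<gamma>) * (q1 - p1)\<^sup>2) / ?C\<^sup>2"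
        by (simp add: u_def v_def power_divide add_divide_distrib power2_commute[of p1])
      thus ?thesis unfolding R using False by simp
    qed
    have on: "u * p1 + v * p2 = 1" "u * q1 + v * q2 = 1"
      using False by (simp_all add: u_def v_def divide_simps) (simp_all add: algebra_simps)
    hence "u \<noteq> 0 \<or> v \<noteq> 0" by auto
    hence "affine hull {(p1, p2), (q1, q2)} = conic_tangent a b \<gamma> ((a - \<gamma>) * u, (b + \<gamma>) * v)"
      using affine_hull_pair_eq_line[OF ne on] nz by (simp add: conic_tangent_def)
    moreover have "((a - \<gamma>) * u, (b + \<gamma>) * v) \<in> confocal_conic a b \<gamma>"
    proof -
      have "u * ((a - \<gamma>) * u) + v * ((b + \<gamma>) * v) = 1"
        using uv by (simp add: power2_eq_square mult_ac)
      thus ?thesis using nz by (simp add: confocal_conic_def power2_eq_square)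
    qed
    ultimately show ?thesis unfolding tangent_to_conic_def by blast
  next
    \<comment> \<open>The line passes through the centre, where no conic of the family has an affine
      tangent. The homogeneous equation now says that its direction is asymptotic.\<close>
    case True
    define w1 where "w1 = q1 - p1"
    define w2 where "w2 = q2 - p2"
    have w: "(w1, w2) \<noteq> 0" using ne by (auto simp: w1_def w2_def zero_prod_def)
    have on: "w2 * p1 + (- w1) * p2 = 0" "w2 * q1 + (- w1) * q2 = 0"
      using True by (simp_all add: w1_def w2_def algebra_simps)
    have on': "w2 * 0 + (- w1) * 0 = 0" "w2 * w1 + (- w1) * w2 = 0" by simp_all
    have w': "w2 \<noteq> 0 \<or> - w1 \<noteq> 0" "(0, 0) \<noteq> (w1, w2)" using w by (auto simp: zero_prod_def)
    have "affine hull {(p1, p2), (q1, q2)} = affine hull {(0, 0), (w1, w2)}"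
      using affine_hull_pair_eq_line[OF ne on w'(1)] affine_hull_pair_eq_line[OF w'(2) on' w'(1)] by simp
    also have "\<dots> = span {(w1, w2)}"
      unfolding affine_hull_pair_eq span_singleton by auto
    finally have "affine hull {(p1, p2), (q1, q2)} = span {(w1, w2)}" .
    moreover have "(fst (w1, w2))\<^sup>2 / (a - \<gamma>) + (snd (w1, w2))\<^sup>2 / (b + \<gamma>) = 0"
      using R True mult_sq_eq_zero_swap[OF nz] by (simp add: w1_def w2_def)
    ultimately show ?thesis
      unfolding tangent_to_conic_def conic_asymptote_def using w by blast
  qed
qed

text \<open>\<open>T\<close> spans the tangent direction, and the parallel part of \<open>v\<close>
  is its Minkowski projection to \<open>T\<close>. Clearing the denominator
  \<open>minkowski T T\<close> leaves a polynomial relation.\<close>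

lemma billiard_reflection_iff:
  assumes "a > 0" "b > 0" "(x, y) \<in> ellipse a b"
  defines "T \<equiv> (y / b, - (x / a))"
  shows "billiard_reflection (conic_tangent a b 0 (x, y)) v r \<longleftrightarrow>
    minkowski T T \<noteq> 0 \<and> minkowski T T *\<^sub>R r = (2 * minkowski v T) *\<^sub>R T - minkowski T T *\<^sub>R v"
proof -
  define L where "L = conic_tangent a b 0 (x, y)"
  have xy: "x * x / a + y * y / b = 1"
    using assms(3) by (simp add: confocal_conic_def power2_eq_square)
  have L: "P \<in> L \<longleftrightarrow> (x / a) * fst P + (y / b) * snd P = 1" for P
    by (cases P) (simp add: L_def conic_tangent_def)
  have P0: "(x, y) \<in> L" using xy by (simp add: L)
  have T0: "T \<noteq> 0" using xy assms(1,2) by (auto simp: T_def zero_prod_def)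
  have dir: "(\<exists>P\<in>L. \<exists>Q\<in>L. u = Q - P) \<longleftrightarrow> (\<exists>c. u = c *\<^sub>R T)" for u
  proof
    assume "\<exists>P\<in>L. \<exists>Q\<in>L. u = Q - P"
    then obtain P Q where "P \<in> L" "Q \<in> L" "u = Q - P" by blast
    hence u: "(x / a) * fst u + (y / b) * snd u = 0"
    proof -
      have "(x / a) * fst (Q - P) + (y / b) * snd (Q - P) =
        ((x / a) * fst Q + (y / b) * snd Q) - ((x / a) * fst P + (y / b) * snd P)"
        unfolding fst_diff snd_diff right_diff_distrib by simp
      thus ?thesis using \<open>P \<in> L\<close> \<open>Q \<in> L\<close> \<open>u = Q - P\<close> by (simp only: L)
    qed
    show "\<exists>c. u = c *\<^sub>R T"
    proof (cases "x = 0")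
      case True
      hence "y \<noteq> 0" using xy by auto
      thus ?thesis using u True assms(1,2)
        by (intro exI[of _ "fst u * b / y"]) (simp add: T_def prod_eq_iff)
    next
      case False
      thus ?thesis using u assms(1,2)
        by (intro exI[of _ "- (snd u) * a / x"]) (simp add: T_def prod_eq_iff field_simps)
    qed
  next
    assume "\<exists>c. u = c *\<^sub>R T"
    then obtain c where c: "u = c *\<^sub>R T" by blast
    have "(x, y) + u \<in> L" using xy by (simp add: L c T_def algebra_simps)
    thus "\<exists>P\<in>L. \<exists>Q\<in>L. u = Q - P" using P0 by (intro bexI[of _ "(x, y)"] bexI[of _ "(x, y) + u"]) auto
  qed
  have mink_scale: "minkowski (c *\<^sub>R X) Y = c * minkowski X Y" "minkowski X (c *\<^sub>R Y) = c * minkowski X Y"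
    "minkowski (X - Z) Y = minkowski X Y - minkowski Z Y" "minkowski (X + Z) Y = minkowski X Y + minkowski Z Y"
    for c X Y Z
    by (simp_all add: minkowski_def algebra_simps)
  have light: "light_like_line L \<longleftrightarrow> minkowski T T = 0"
  proof
    assume "light_like_line L"
    then obtain P Q where PQ: "P \<in> L" "Q \<in> L" "P \<noteq> Q" "minkowski (Q - P) (Q - P) = 0"
      unfolding light_like_line_def light_like_def by blast
    moreover obtain c where c: "Q - P = c *\<^sub>R T" using PQ dir by blast
    ultimately have "c \<noteq> 0" by auto
    thus "minkowski T T = 0" using PQ(4) unfolding c mink_scale by simp
  next
    assume "minkowski T T = 0"
    moreover have "(x, y) + T \<in> L" using xy by (simp add: L T_def algebra_simps)
    ultimately show "light_like_line L"
      unfolding light_like_line_def light_like_def using P0 T0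
      by (intro bexI[of _ "(x, y)"] bexI[of _ "(x, y) + T"]) auto
  qed
  have par: "parallel_to_line u L \<longleftrightarrow> (\<exists>c. u = c *\<^sub>R T)" for u
    unfolding parallel_to_line_def by (rule dir)
  have orth: "orthogonal_to_line w L \<longleftrightarrow> minkowski w T = 0" for w
  proof -
    have "orthogonal_to_line w L \<longleftrightarrow> (\<forall>u. (\<exists>P\<in>L. \<exists>Q\<in>L. u = Q - P) \<longrightarrow> minkowski w u = 0)"
      unfolding orthogonal_to_line_def by blast
    also have "\<dots> \<longleftrightarrow> (\<forall>c. minkowski w (c *\<^sub>R T) = 0)" unfolding dir by blast
    also have "\<dots> \<longleftrightarrow> minkowski w T = 0"
      unfolding mink_scale by (auto dest: spec[of _ 1])
    finally show ?thesis .
  qed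
  show ?thesis
    unfolding L_def[symmetric] billiard_reflection_def light par orth
  proof (intro conj_cong refl iffI)
    assume nz: "minkowski T T \<noteq> 0"
    assume "\<exists>u w. v = u + w \<and> (\<exists>c. u = c *\<^sub>R T) \<and> minkowski w T = 0 \<and> r = u - w"
    then obtain c w where w: "v = c *\<^sub>R T + w" "minkowski w T = 0" "r = c *\<^sub>R T - w" by blast
    have c: "minkowski v T = c * minkowski T T" by (simp add: w mink_scale)
    have r: "r = (2 * c) *\<^sub>R T - v" by (simp add: w(1,3) algebra_simps flip: scaleR_2)
    show "minkowski T T *\<^sub>R r = (2 * minkowski v T) *\<^sub>R T - minkowski T T *\<^sub>R v"
      unfolding c r by (simp add: scaleR_diff_right mult_ac)
  next
    assume nz: "minkowski T T \<noteq> 0"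
    assume r: "minkowski T T *\<^sub>R r = (2 * minkowski v T) *\<^sub>R T - minkowski T T *\<^sub>R v"
    define c where "c = minkowski v T / minkowski T T"
    have c: "minkowski v T = c * minkowski T T" using nz by (simp add: c_def)
    have "minkowski T T *\<^sub>R r = minkowski T T *\<^sub>R ((2 * c) *\<^sub>R T - v)"
      unfolding r c by (simp add: algebra_simps)
    hence "r = (2 * c) *\<^sub>R T - v" using nz by simp
    hence "r = c *\<^sub>R T - (v - c *\<^sub>R T)" by (simp add: algebra_simps flip: scaleR_2)
    moreover have "minkowski (v - c *\<^sub>R T) T = 0" by (simp add: mink_scale c)
    ultimately show "\<exists>u w. v = u + w \<and> (\<exists>c. u = c *\<^sub>R T) \<and> minkowski w T = 0 \<and> r = u - w"
      by (intro exI[of _ "c *\<^sub>R T"] exI[of _ "v - c *\<^sub>R T"]) auto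
  qed
qed

text \<open>
  The projection of the ellipse from its point \<open>(a, b) / sqrt (a + b)\<close>, where the tangent is light-like:
  trajectories never meet the omitted point \<open>s = \<infinity>\<close>.
\<close>

definition ellipse_point :: "real \<Rightarrow> real \<Rightarrow> real \<Rightarrow> real \<times> real" where
  "ellipse_point a b s =
     ((a * (s\<^sup>2 - 1) + 2 * sqrt (a * b) * s) / (sqrt (a + b) * (s\<^sup>2 + 1)),
      (b * (s\<^sup>2 - 1) - 2 * sqrt (a * b) * s) / (sqrt (a + b) * (s\<^sup>2 + 1)))"

text \<open>The difference of two points of the ellipse with the factor \<open>u - s\<close> and the
  positive denominators removed. It is symmetric, affine in \<open>u\<close>, and for
  \<open>u = s\<close> it still gives the tangent direction.\<close>

definition chord_dir :: "real \<Rightarrow> real \<Rightarrow> real \<Rightarrow> real \<Rightarrow> real \<times> real" where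
  "chord_dir a b s u = (a * (s + u) + sqrt (a * b) * (1 - s * u), b * (s + u) - sqrt (a * b) * (1 - s * u))"

text \<open>Up to the factor \<open>a + b\<close>, the Minkowski product of the chord direction and the tangent direction \<open>chord_dir a b s s\<close> at \<open>s\<close>.\<close>

definition chord_form :: "real \<Rightarrow> real \<Rightarrow> real \<Rightarrow> real \<Rightarrow> real" where
  "chord_form a b s u = sqrt (a * b) * ((s + u) * (1 - s\<^sup>2) + 2 * s * (1 - s * u)) - 2 * (b - a) * s * (s + u)"

text \<open>The reflection law for three parameters without vectors: eliminating \<open>k\<close>
  from the two scalar equations in \<open>reflected_chord_dir_iff\<close> gives this
  relation.\<close>

definition reflected_chords :: "real \<Rightarrow> real \<Rightarrow> real \<Rightarrow> real \<Rightarrow> real \<Rightarrow> bool" where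
  "reflected_chords a b u s v \<longleftrightarrow> 2 * chord_form a b s u * (v - s) = chord_form a b s s * (v - u)"

lemma square_add_1_pos: "(s :: real)\<^sup>2 + 1 > 0" "(s :: real)\<^sup>2 + 1 \<noteq> 0" "1 + (s :: real)\<^sup>2 \<noteq> 0"
  using zero_le_power2[of s] by linarith+

lemma ellipse_point_in_ellipse:
  assumes "a > 0" "b > 0"
  shows "ellipse_point a b s \<in> ellipse a b"
proof -
  define t c N where "t = sqrt (a * b)" and "c = sqrt (a + b)" and "N = s\<^sup>2 + 1"
  have t: "t\<^sup>2 = a * b" and c: "c\<^sup>2 = a + b" and N: "N \<noteq> 0"
    using assms square_add_1_pos by (auto simp: t_def c_def N_def)
  have c0: "c \<noteq> 0" using assms by (simp add: c_def)
  have "b * (a * (s\<^sup>2 - 1) + 2 * t * s)\<^sup>2 + a * (b * (s\<^sup>2 - 1) - 2 * t * s)\<^sup>2 =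
      a * b * (a + b) * (s\<^sup>2 - 1)\<^sup>2 + 4 * (a + b) * t\<^sup>2 * s\<^sup>2"
    by (simp add: power2_eq_square algebra_simps)
  also have "\<dots> = a * b * (c\<^sup>2 * N\<^sup>2)"
    unfolding t c N_def by (simp add: power2_eq_square algebra_simps)
  finally have eq: "b * (a * (s\<^sup>2 - 1) + 2 * t * s)\<^sup>2 + a * (b * (s\<^sup>2 - 1) - 2 * t * s)\<^sup>2 = a * b * (c * N)\<^sup>2"
    by (simp add: power_mult_distrib)
  have "(X / (c * N))\<^sup>2 / a + (Y / (c * N))\<^sup>2 / b = (b * X\<^sup>2 + a * Y\<^sup>2) / (a * b * (c * N)\<^sup>2)" for X Y
    using assms N c0 by (simp add: power_divide field_simps)
  from this[of "a * (s\<^sup>2 - 1) + 2 * t * s" "b * (s\<^sup>2 - 1) - 2 * t * s"] show ?thesis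
    unfolding eq using assms N c0
    by (simp add: confocal_conic_def ellipse_point_def t_def c_def N_def)
qed

lemma ellipse_point_diff:
  assumes "a > 0" "b > 0"
  shows "ellipse_point a b u - ellipse_point a b s =
    (2 * (u - s) / (sqrt (a + b) * (s\<^sup>2 + 1) * (u\<^sup>2 + 1))) *\<^sub>R chord_dir a b s u"
proof -
  define t c where "t = sqrt (a * b)" and "c = sqrt (a + b)"
  have c0: "c \<noteq> 0" using assms by (simp add: c_def)
  have frac: "X / (c * M) - Y / (c * N) = (X * N - Y * M) / (c * N * M)"
    if "M \<noteq> 0" "N \<noteq> 0" for X Y M N
    using that c0 by (simp add: divide_simps)
  have diff: "X / (c * (u\<^sup>2 + 1)) - Y / (c * (s\<^sup>2 + 1)) = 2 * (u - s) / (c * (s\<^sup>2 + 1) * (u\<^sup>2 + 1)) * Z"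
    if "X * (s\<^sup>2 + 1) - Y * (u\<^sup>2 + 1) = 2 * (u - s) * Z" for X Y Z
    unfolding frac[OF square_add_1_pos(2) square_add_1_pos(2)] that by simp
  have "(a * (u\<^sup>2 - 1) + 2 * t * u) * (s\<^sup>2 + 1) - (a * (s\<^sup>2 - 1) + 2 * t * s) * (u\<^sup>2 + 1) =
      2 * (u - s) * (a * (s + u) + t * (1 - s * u))"
    "(b * (u\<^sup>2 - 1) - 2 * t * u) * (s\<^sup>2 + 1) - (b * (s\<^sup>2 - 1) - 2 * t * s) * (u\<^sup>2 + 1) =
      2 * (u - s) * (b * (s + u) - t * (1 - s * u))"
    by (simp_all add: power2_eq_square algebra_simps)
  from this[THEN diff] show ?thesis
    unfolding ellipse_point_def chord_dir_def t_def[symmetric] c_def[symmetric]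
    by (simp only: diff_Pair scaleR_Pair real_scaleR_def)
qed

lemma tangent_dir_ellipse_point:
  assumes "a > 0" "b > 0" "ellipse_point a b s = (x, y)"
  shows "(y / b, - (x / a)) = (- 1 / (sqrt (a + b) * sqrt (a * b) * (s\<^sup>2 + 1))) *\<^sub>R chord_dir a b s s"
proof -
  define t c N where "t = sqrt (a * b)" and "c = sqrt (a + b)" and "N = s\<^sup>2 + 1"
  have t: "t * t = a * b" "t \<noteq> 0" and c: "c \<noteq> 0" and N: "N \<noteq> 0"
    using assms square_add_1_pos by (auto simp: t_def c_def N_def)
  have xy: "x = (a * (s\<^sup>2 - 1) + 2 * t * s) / (c * N)" "y = (b * (s\<^sup>2 - 1) - 2 * t * s) / (c * N)"
    using assms(3) by (auto simp: ellipse_point_def t_def c_def N_def)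
  have "t * (b * (s\<^sup>2 - 1) - 2 * t * s) = b * (t * (s\<^sup>2 - 1)) - 2 * (t * t) * s"
    by (simp add: algebra_simps)
  also have "\<dots> = - (b * (a * (s + s) + t * (1 - s * s)))"
    unfolding t by (simp add: algebra_simps power2_eq_square)
  finally have 1: "t * (b * (s\<^sup>2 - 1) - 2 * t * s) = - (b * (a * (s + s) + t * (1 - s * s)))" .
  have "t * (a * (s\<^sup>2 - 1) + 2 * t * s) = a * (t * (s\<^sup>2 - 1)) + 2 * (t * t) * s"
    by (simp add: algebra_simps)
  also have "\<dots> = a * (b * (s + s) - t * (1 - s * s))"
    unfolding t by (simp add: algebra_simps power2_eq_square)
  finally have 2: "t * (a * (s\<^sup>2 - 1) + 2 * t * s) = a * (b * (s + s) - t * (1 - s * s))" .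
  have "y / b = (t * (b * (s\<^sup>2 - 1) - 2 * t * s)) / (b * (c * t * N))"
    using t c N assms by (simp add: xy)
  also have "\<dots> = - 1 / (c * t * N) * (a * (s + s) + t * (1 - s * s))"
    unfolding 1 using assms by simp
  finally have y: "y / b = - 1 / (c * t * N) * (a * (s + s) + t * (1 - s * s))" .
  have "x / a = (t * (a * (s\<^sup>2 - 1) + 2 * t * s)) / (a * (c * t * N))"
    using t c N assms by (simp add: xy)
  also have "\<dots> = 1 / (c * t * N) * (b * (s + s) - t * (1 - s * s))"
    unfolding 2 using assms by simp
  finally have x: "- (x / a) = - 1 / (c * t * N) * (b * (s + s) - t * (1 - s * s))" by simp
  show ?thesis
    unfolding chord_dir_def t_def[symmetric] c_def[symmetric] N_def[symmetric] x y by simp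
qed

lemma minkowski_chord_dir:
  assumes "a > 0" "b > 0"
  shows "minkowski (chord_dir a b s u) (chord_dir a b s s) = (a + b) * chord_form a b s u"
  unfolding minkowski_def chord_dir_def chord_form_def
  by (simp add: algebra_simps power2_eq_square)

lemma minkowski_scale:
  "minkowski (c *\<^sub>R X) Y = c * minkowski X Y" "minkowski X (c *\<^sub>R Y) = c * minkowski X Y"
  by (simp_all add: minkowski_def algebra_simps)

lemma chord_dir_combination_zero_iff:
  assumes "a > 0" "b > 0"
  shows "e *\<^sub>R chord_dir a b s 0 + f *\<^sub>R (chord_dir a b s 1 - chord_dir a b s 0) = 0 \<longleftrightarrow> e = 0 \<and> f = 0"
proof
  define t where "t = sqrt (a * b)"
  have t: "t > 0" using assms by (simp add: t_def)
  assume "e *\<^sub>R chord_dir a b s 0 + f *\<^sub>R (chord_dir a b s 1 - chord_dir a b s 0) = 0"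
  hence 1: "a * (e * s + f) + t * (e - f * s) = 0" and 2: "b * (e * s + f) - t * (e - f * s) = 0"
    by (simp_all add: chord_dir_def prod_eq_iff t_def algebra_simps)
  have "(a + b) * (e * s + f) = 0" using 1 2 by (simp add: algebra_simps)
  hence A: "e * s + f = 0" using assms by simp
  with 1 t have B: "e - f * s = 0" by simp
  have "e * (s\<^sup>2 + 1) = 0" "f * (s\<^sup>2 + 1) = 0"
    using A B by (simp_all add: power2_eq_square algebra_simps) (metis add.commute eq_iff_diff_eq_0 mult.commute mult.left_commute mult_minus_left add_eq_0_iff)+
  thus "e = 0 \<and> f = 0" using square_add_1_pos by simp
qed simp

lemma chord_dir_split:
  "chord_dir a b s u = chord_dir a b s 0 + u *\<^sub>R (chord_dir a b s 1 - chord_dir a b s 0)"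
  by (simp add: chord_dir_def prod_eq_iff algebra_simps)

lemma chord_dir_nonzero: "a > 0 \<Longrightarrow> b > 0 \<Longrightarrow> chord_dir a b s u \<noteq> 0"
  using chord_dir_combination_zero_iff[of a b 1 s u] unfolding chord_dir_split[of a b s u] by simp

lemma reflected_chord_dir_iff:
  assumes "a > 0" "b > 0"
  shows "(2 * chord_form a b s u) *\<^sub>R chord_dir a b s s - chord_form a b s s *\<^sub>R chord_dir a b s u =
      k *\<^sub>R chord_dir a b s v \<longleftrightarrow>
    k = 2 * chord_form a b s u - chord_form a b s s \<and> 2 * chord_form a b s u * s - chord_form a b s s * u = k * v"
proof -
  define E F where "E = chord_dir a b s 0" and "F = chord_dir a b s 1 - chord_dir a b s 0"
  define h H where "h = chord_form a b s u" and "H = chord_form a b s s"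
  have dir: "chord_dir a b s x = E + x *\<^sub>R F" for x
    unfolding E_def F_def by (rule chord_dir_split)
  have "(2 * h) *\<^sub>R (E + s *\<^sub>R F) - H *\<^sub>R (E + u *\<^sub>R F) = k *\<^sub>R (E + v *\<^sub>R F) \<longleftrightarrow>
    (2 * h - H - k) *\<^sub>R E + (2 * h * s - H * u - k * v) *\<^sub>R F = 0"
    by (simp add: algebra_simps eq_diff_eq)
  also have "\<dots> \<longleftrightarrow> 2 * h - H - k = 0 \<and> 2 * h * s - H * u - k * v = 0"
    unfolding E_def F_def by (rule chord_dir_combination_zero_iff[OF assms])
  finally show ?thesis unfolding dir h_def[symmetric] H_def[symmetric] by auto
qed

lemma ellipse_point_inj:
  assumes "a > 0" "b > 0"
  shows "ellipse_point a b u = ellipse_point a b s \<longleftrightarrow> u = s"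
proof
  assume "ellipse_point a b u = ellipse_point a b s"
  hence "(2 * (u - s) / (sqrt (a + b) * (s\<^sup>2 + 1) * (u\<^sup>2 + 1))) *\<^sub>R chord_dir a b s u = 0"
    using ellipse_point_diff[OF assms, of u s] by simp
  thus "u = s" using chord_dir_nonzero[OF assms] assms square_add_1_pos by auto
qed simp

text \<open>The zeros \<open>0\<close>, \<open>a / sqrt (a * b)\<close> and
  \<open>- b / sqrt (a * b)\<close> are three of the four points with a light-like tangent. The
  fourth is the omitted point of the parametrization.\<close>

lemma chord_form_self:
  "chord_form a b s s = 4 * s * (sqrt (a * b) * (1 - s\<^sup>2) - (b - a) * s)"
  by (simp add: chord_form_def algebra_simps power2_eq_square)

lemma billiard_reflection_ellipse_point_iff:
  fixes s :: real
  assumes "a > 0" "b > 0"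
  defines "H \<equiv> chord_form a b s s"
  shows "billiard_reflection (conic_tangent a b 0 (ellipse_point a b s)) (k *\<^sub>R chord_dir a b s u) r \<longleftrightarrow>
    H \<noteq> 0 \<and> H *\<^sub>R r = k *\<^sub>R ((2 * chord_form a b s u) *\<^sub>R chord_dir a b s s - H *\<^sub>R chord_dir a b s u)"
proof -
  obtain x y where xy: "ellipse_point a b s = (x, y)" by fastforce
  define e where "e = - 1 / (sqrt (a + b) * sqrt (a * b) * (s\<^sup>2 + 1))"
  have e: "e \<noteq> 0" using assms square_add_1_pos by (auto simp: e_def)
  have T: "(y / b, - (x / a)) = e *\<^sub>R chord_dir a b s s"
    unfolding e_def by (rule tangent_dir_ellipse_point[OF assms(1,2) xy])
  have m: "minkowski (e *\<^sub>R chord_dir a b s s) (e *\<^sub>R chord_dir a b s s) = (e * e * (a + b)) * H"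
    "minkowski (k *\<^sub>R chord_dir a b s u) (e *\<^sub>R chord_dir a b s s) = (e * k * (a + b)) * chord_form a b s u"
    by (simp_all add: minkowski_scale minkowski_chord_dir[OF assms(1,2)] H_def)
  define q where "q = e * e * (a + b)"
  have q: "q \<noteq> 0" using e assms by (simp add: q_def)
  have "billiard_reflection (conic_tangent a b 0 (x, y)) (k *\<^sub>R chord_dir a b s u) r \<longleftrightarrow>
    q * H \<noteq> 0 \<and> (q * H) *\<^sub>R r = (2 * ((e * k * (a + b)) * chord_form a b s u)) *\<^sub>R (e *\<^sub>R chord_dir a b s s)
       - (q * H) *\<^sub>R (k *\<^sub>R chord_dir a b s u)"
    using billiard_reflection_iff[OF assms(1,2), of x y "k *\<^sub>R chord_dir a b s u" r]
      ellipse_point_in_ellipse[OF assms(1,2), of s]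
    unfolding xy T m q_def by blast
  also have "(q * H) *\<^sub>R r = q *\<^sub>R (H *\<^sub>R r)" by simp
  also have "(2 * ((e * k * (a + b)) * chord_form a b s u)) *\<^sub>R (e *\<^sub>R chord_dir a b s s)
       - (q * H) *\<^sub>R (k *\<^sub>R chord_dir a b s u) =
     q *\<^sub>R (k *\<^sub>R ((2 * chord_form a b s u) *\<^sub>R chord_dir a b s s - H *\<^sub>R chord_dir a b s u))"
    unfolding scaleR_right_diff_distrib scaleR_scaleR q_def by (simp only: mult_ac)
  finally show ?thesis unfolding xy scaleR_cancel_left mult_eq_0_iff using q by blast
qed

lemma ex_ellipse_point:
  assumes "a > 0" "b > 0" "(x, y) \<in> ellipse a b" "(y / b)\<^sup>2 \<noteq> (x / a)\<^sup>2"
  shows "\<exists>s. (x, y) = ellipse_point a b s"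
proof -
  define t c where "t = sqrt (a * b)" and "c = sqrt (a + b)"
  have t: "t * t = a * b" "t \<noteq> 0" and c: "c * c = a + b" "c > 0"
    using assms by (auto simp: t_def c_def)
  have "x\<^sup>2 / a + y\<^sup>2 / b = 1" using assms(3) by (simp add: confocal_conic_def)
  hence xy: "b * x\<^sup>2 + a * y\<^sup>2 = a * b" using assms(1,2) by (simp add: field_simps)
  define m where "m = c - (x + y)"
  define w where "w = b * x - a * y"
  have w: "w\<^sup>2 = (a * b) * ((c + (x + y)) * (c - (x + y)))"
  proof -
    have "(a * b) * ((c + (x + y)) * (c - (x + y))) = (a * b) * (c * c - (x + y)\<^sup>2)"
      by (simp add: algebra_simps power2_eq_square)
    also have "\<dots> = (a + b) * (a * b) - a * b * (x + y)\<^sup>2" unfolding c by (simp add: algebra_simps)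
    also have "\<dots> = (a + b) * (b * x\<^sup>2 + a * y\<^sup>2) - a * b * (x + y)\<^sup>2" unfolding xy ..
    also have "\<dots> = w\<^sup>2" by (simp add: w_def algebra_simps power2_eq_square)
    finally show ?thesis by simp
  qed
  have "m \<noteq> 0"
  proof
    assume "m = 0"
    hence "w = 0" using w by (simp add: m_def)
    hence "y / b = x / a" using assms(1,2) by (simp add: w_def field_simps)
    thus False using assms(4) by simp
  qed
  \<comment> \<open>The inverse of the projection. On the ellipse \<open>w\<^sup>2\<close> factors
    into \<open>c + (x + y)\<close> and \<open>c - (x + y)\<close>, so \<open>s\<^sup>2\<close>
    depends on \<open>x + y\<close> alone.\<close>
  define s where "s = w / (t * m)"
  have "s\<^sup>2 = w\<^sup>2 / ((t * t) * m\<^sup>2)" by (simp add: s_def power_divide power2_eq_square mult_ac)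
  also have "\<dots> = (c + (x + y)) / m"
    unfolding w t m_def[symmetric] using \<open>m \<noteq> 0\<close> assms(1,2) by (simp add: power2_eq_square)
  finally have s2: "s\<^sup>2 = (c + (x + y)) / m" .
  have s2p: "s\<^sup>2 + 1 = 2 * c / m" and s2m: "s\<^sup>2 - 1 = 2 * (x + y) / m"
    unfolding s2 using \<open>m \<noteq> 0\<close> by (simp_all add: field_simps) (simp_all add: m_def)
  have ts: "2 * t * s = 2 * w / m" using t by (simp add: s_def)
  have "c * (s\<^sup>2 + 1) = 2 * (a + b) / m" unfolding s2p using c by simp
  moreover have "a * (s\<^sup>2 - 1) + 2 * t * s = 2 * (a + b) * x / m" "b * (s\<^sup>2 - 1) - 2 * t * s = 2 * (a + b) * y / m"
    unfolding s2m ts w_def using \<open>m \<noteq> 0\<close> by (simp_all add: field_simps)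
  ultimately have "ellipse_point a b s = (x, y)"
    unfolding ellipse_point_def t_def[symmetric] c_def[symmetric]
    using \<open>m \<noteq> 0\<close> assms(1,2) by simp
  thus ?thesis by metis
qed

text \<open>In the dual equation the factor of the chord direction cancels, and with
  \<open>t * t = a * b\<close> so does the common factor \<open>a + b\<close>. What is left is the
  symmetric form of \<open>chord_touches\<close>.\<close>

lemma tangent_chord_iff:
  assumes "a > 0" "b > 0" "\<gamma> \<noteq> a" "\<gamma> \<noteq> - b" "s \<noteq> u"
  shows "tangent_to_conic a b \<gamma> (affine hull {ellipse_point a b s, ellipse_point a b u}) \<longleftrightarrow>
    chord_touches a b \<gamma> s u"
proof -
  obtain p1 p2 q1 q2 where pq: "ellipse_point a b s = (p1, p2)" "ellipse_point a b u = (q1, q2)"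
    by fastforce
  define t c where "t = sqrt (a * b)" and "c = sqrt (a + b)"
  have t: "t * t = a * b" "t > 0" and c: "c * c = a + b" "c > 0"
    using assms by (auto simp: t_def c_def)
  define \<rho> where "\<rho> = 2 * (u - s) / (c * (s\<^sup>2 + 1) * (u\<^sup>2 + 1))"
  have \<rho>: "\<rho> \<noteq> 0" using assms(5) c square_add_1_pos by (simp add: \<rho>_def)
  define A B where "A = s + u" and "B = 1 - s * u"
  have "(q1 - p1, q2 - p2) = \<rho> *\<^sub>R chord_dir a b s u"
    using ellipse_point_diff[OF assms(1,2), of u s] by (simp add: pq \<rho>_def c_def)
  hence d: "q1 - p1 = \<rho> * (a * A + t * B)" "q2 - p2 = \<rho> * (b * A - t * B)"
    by (simp_all add: chord_dir_def A_def B_def t_def)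
  have cross: "p1 * q2 - p2 * q1 = \<rho> * (t * c) * (1 + s * u)"
  proof -
    define N M where "N = s\<^sup>2 + 1" and "M = u\<^sup>2 + 1"
    have NM: "N \<noteq> 0" "M \<noteq> 0" using square_add_1_pos by (auto simp: N_def M_def)
    have "p1 = (a * (s\<^sup>2 - 1) + 2 * t * s) / (c * N)" "p2 = (b * (s\<^sup>2 - 1) - 2 * t * s) / (c * N)"
      "q1 = (a * (u\<^sup>2 - 1) + 2 * t * u) / (c * M)" "q2 = (b * (u\<^sup>2 - 1) - 2 * t * u) / (c * M)"
      using pq by (simp_all add: ellipse_point_def t_def c_def N_def M_def)
    hence "p1 * q2 - p2 * q1 = ((a * (s\<^sup>2 - 1) + 2 * t * s) * (b * (u\<^sup>2 - 1) - 2 * t * u)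
        - (b * (s\<^sup>2 - 1) - 2 * t * s) * (a * (u\<^sup>2 - 1) + 2 * t * u)) / ((c * N) * (c * M))"
      by (simp only: times_divide_times_eq diff_divide_distrib[symmetric])
    also have "(a * (s\<^sup>2 - 1) + 2 * t * s) * (b * (u\<^sup>2 - 1) - 2 * t * u)
        - (b * (s\<^sup>2 - 1) - 2 * t * s) * (a * (u\<^sup>2 - 1) + 2 * t * u) = (c * c) * (2 * t * (u - s) * (1 + s * u))"
      unfolding c by (simp add: algebra_simps power2_eq_square)
    also have "(c * c) * (2 * t * (u - s) * (1 + s * u)) / ((c * N) * (c * M)) = \<rho> * t * (1 + s * u) * c"
      using c(2) NM unfolding \<rho>_def N_def[symmetric] M_def[symmetric] by (simp add: divide_simps)
    finally show ?thesis by (simp add: mult_ac)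
  qed
  have ne: "(p1, p2) \<noteq> (q1, q2)"
    using ellipse_point_inj[OF assms(1,2), of s u] assms(5) pq by simp
  have "tangent_to_conic a b \<gamma> (affine hull {(p1, p2), (q1, q2)}) \<longleftrightarrow>
      (a - \<gamma>) * (\<rho> * (b * A - t * B))\<^sup>2 + (b + \<gamma>) * (\<rho> * (a * A + t * B))\<^sup>2 = (\<rho> * (t * c) * (1 + s * u))\<^sup>2"
    unfolding tangent_to_conic_hull_iff[OF assms(3,4) ne] d cross ..
  also have "\<dots> \<longleftrightarrow> \<rho>\<^sup>2 * ((a - \<gamma>) * (b * A - t * B)\<^sup>2 + (b + \<gamma>) * (a * A + t * B)\<^sup>2) =
      \<rho>\<^sup>2 * ((t * t) * (c * c) * (1 + s * u)\<^sup>2)"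
    by (simp add: power2_eq_square algebra_simps)
  also have "\<dots> \<longleftrightarrow> (a - \<gamma>) * (b * A - t * B)\<^sup>2 + (b + \<gamma>) * (a * A + t * B)\<^sup>2 = (t * t) * (c * c) * (1 + s * u)\<^sup>2"
    using \<rho> by simp
  also have "(a - \<gamma>) * (b * A - t * B)\<^sup>2 + (b + \<gamma>) * (a * A + t * B)\<^sup>2 =
      (a + b) * ((a * b) * A\<^sup>2 + (t * t) * B\<^sup>2 + \<gamma> * A * ((a - b) * A + 2 * t * B))"
    by (simp add: power2_eq_square algebra_simps)
  also have "\<dots> = (t * t) * (c * c) * (1 + s * u)\<^sup>2 \<longleftrightarrow>
      (a * b) * A\<^sup>2 + (a * b) * B\<^sup>2 + \<gamma> * A * ((a - b) * A + 2 * t * B) = (a * b) * (1 + s * u)\<^sup>2"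
    unfolding t c using assms(1,2) by (simp add: mult_ac)
  also have "\<dots> \<longleftrightarrow> a * b * (s - u)\<^sup>2 = \<gamma> * (s + u) * (2 * t * (s * u - 1) + (b - a) * (s + u))"
    by (simp add: A_def B_def power2_eq_square algebra_simps)
  also have "\<dots> \<longleftrightarrow> chord_touches a b \<gamma> s u"
    unfolding chord_touches_iff[OF assms(1,2)] t_def ..
  finally show ?thesis unfolding pq .
qed

lemma chord_form_split:
  "chord_form a b s u = sqrt (a * b) * (3 * s + u - s ^ 3 - 3 * s\<^sup>2 * u) - 2 * (b - a) * s * (s + u)"
  by (simp add: chord_form_def algebra_simps power2_eq_square power3_eq_cube)

text \<open>The Minkowski form of the equal-angle property of confocal conics. The reflection law is
  symmetric in \<open>u\<close> and \<open>v\<close>, hence linear in \<open>u + v\<close> and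
  \<open>u * v\<close>; inserting the sum and product of the roots makes it an identity.\<close>

lemma reflected_chords_if_poncelet_step:
  assumes "a > 0" "b > 0" "s \<noteq> 0" "poncelet_step a b \<gamma> u s v"
  shows "reflected_chords a b u s v"
proof -
  define t A where "t = sqrt (a * b)" and "A = polar_lead a b \<gamma> s"
  have t: "t * t = a * b" using assms by (simp add: t_def)
  have A0: "A \<noteq> 0"
    using poncelet_step_param_x(3)[OF assms(1,2,4,3)] by (simp add: A_def)
  have vieta: "A * (u + v) = - polar_mid a b \<gamma> s" "A * (u * v) = polar_const a b \<gamma> s"
    using assms(4) by (auto simp: poncelet_step_def A_def)
  have mid: "polar_mid a b \<gamma> s = - 2 * (t * t) * s - \<gamma> * (2 * t * s\<^sup>2 - 2 * t + 2 * (b - a) * s)"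
    and con: "polar_const a b \<gamma> s = (t * t) * s\<^sup>2 - \<gamma> * ((b - a) * s\<^sup>2 - 2 * t * s)"
    and lead: "A = t * t - \<gamma> * (2 * t * s + (b - a))"
    unfolding polar_mid_def polar_const_def polar_lead_def A_def t_def[symmetric] t by simp_all
  have "A * (2 * chord_form a b s u * (v - s) - chord_form a b s s * (v - u)) =
     2 * (t * (1 - 3 * s\<^sup>2) - 2 * (b - a) * s) * (A * (u * v)) + (2 * t * s + 2 * t * s ^ 3) * (A * (u + v))
       - 2 * s * (t * (3 * s - s ^ 3) - 2 * (b - a) * s\<^sup>2) * A"
    unfolding chord_form_split t_def[symmetric]
    by (simp add: algebra_simps power2_eq_square power3_eq_cube)
  also have "\<dots> = 0"
    unfolding vieta unfolding mid con lead
    by (simp add: algebra_simps power2_eq_square power3_eq_cube)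
  finally show ?thesis using A0 by (simp add: reflected_chords_def)
qed

lemma poncelet_step_if_reflected_chords:
  assumes ab: "a > 0" "b > 0" and "s \<noteq> 0" "u \<noteq> s" "v \<noteq> s"
    and u: "chord_touches a b \<gamma> s u" and v: "chord_touches a b \<gamma> s v"
    and refl: "reflected_chords a b u s v"
  shows "poncelet_step a b \<gamma> u s v"
proof -
  define t A B C where "t = sqrt (a * b)" and "A = polar_lead a b \<gamma> s" and "B = polar_mid a b \<gamma> s"
    and "C = polar_const a b \<gamma> s"
  have t: "t * t = a * b" "t > 0" using ab by (auto simp: t_def)
  have u0: "A * u\<^sup>2 + B * u + C = 0" and v0: "A * v\<^sup>2 + B * v + C = 0"
    using u v by (auto simp: chord_touches_def A_def B_def C_def)
  have sum: "A * (u + v) = - B"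
  proof (cases "u = v")
    case False
    have "(u - v) * (A * (u + v) + B) = (A * u\<^sup>2 + B * u + C) - (A * v\<^sup>2 + B * v + C)"
      by (simp add: algebra_simps power2_eq_square)
    hence "A * (u + v) + B = 0" using False by (simp add: u0 v0)
    thus ?thesis by simp
  next
    case True
    \<comment> \<open>A chord reflected into itself is orthogonal to the tangent. It has to be a
      double root, that is, \<open>2 * A * u + B = 0\<close>; the factor \<open>(s + u) * M\<close>
      allows the tangency condition to eliminate \<open>\<gamma>\<close>.\<close>
    have h: "chord_form a b s u = 0"
      using refl True assms(4) by (simp add: reflected_chords_def)
    define M where "M = 2 * t * (s * u - 1) + (b - a) * (s + u)"
    have M: "\<gamma> * (s + u) * M = t * t * (s - u)\<^sup>2"
      using u unfolding chord_touches_iff[OF ab] t_def[symmetric] t M_def by simp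
    have "s + u \<noteq> 0" by (rule sum_nonzero_if_chord_touches[OF ab u assms(3)])
    moreover have "\<gamma> * (s + u) * M \<noteq> 0" unfolding M using t ab assms(4) by simp
    ultimately have nz: "(s + u) * M \<noteq> 0" by auto
    have deriv: "2 * A * u + B = - 2 * (t * t) * (s - u) - \<gamma> * (M + (s + u) * (2 * t * s + (b - a)))"
      unfolding A_def B_def polar_lead_def polar_mid_def M_def t_def[symmetric] t
      by (simp add: algebra_simps power2_eq_square)
    have "(s + u) * M * (2 * A * u + B) =
       - 2 * (t * t) * (s - u) * ((s + u) * M) - (\<gamma> * (s + u) * M) * (M + (s + u) * (2 * t * s + (b - a)))"
      unfolding deriv by (simp add: algebra_simps)
    also have "\<dots> = - (t * t) * (s - u) * (2 * (s + u) * M + (s - u) * (M + (s + u) * (2 * t * s + (b - a))))"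
      unfolding M by (simp add: algebra_simps power2_eq_square)
    also have "2 * (s + u) * M + (s - u) * (M + (s + u) * (2 * t * s + (b - a))) = - 2 * chord_form a b s u"
      unfolding chord_form_split M_def t_def[symmetric]
      by (simp add: algebra_simps power2_eq_square power3_eq_cube)
    finally have "2 * A * u + B = 0" using nz unfolding h by simp
    thus ?thesis using True by (simp add: algebra_simps)
  qed
  have "A * (u * v) - C = u * (A * (u + v)) - A * u\<^sup>2 - C"
    by (simp add: algebra_simps power2_eq_square)
  also have "\<dots> = 0" unfolding sum using u0 by (simp add: algebra_simps)
  finally show ?thesis
    using u sum by (simp add: poncelet_step_def A_def B_def C_def)
qed

text \<open>The source of the condition \<open>c > 0\<close> in a trajectory: the reflection law
  makes this product the square of \<open>H * (u - s)\<close>, so the reflected vector points to the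
  next vertex.\<close>

lemma chord_form_self_nonzero_step:
  assumes refl: "2 * h * (v - s) = H * (v - u)" and "(H :: real) \<noteq> 0" "u \<noteq> s" "v \<noteq> s"
  shows "- (2 * h - H) * (u - s) * (v - s) * H > 0"
proof -
  have "(2 * h - H) * (v - s) = - (H * (u - s))"
    using refl by (simp add: algebra_simps)
  hence "- (2 * h - H) * (u - s) * (v - s) * H = (H * (u - s))\<^sup>2"
    by (metis (no_types, opaque_lifting) minus_mult_minus mult.assoc mult.commute mult_minus_left power2_eq_square)
  thus ?thesis using assms by simp
qed

text \<open>The condition \<open>chord_form a b s s \<noteq> 0\<close> excludes the points of the ellipse with a light-like tangent.\<close>

lemma reflection_step_iff:
  assumes ab: "a > 0" "b > 0" and ne: "u \<noteq> s" "v \<noteq> s"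
  defines "P \<equiv> ellipse_point a b"
  shows "(\<exists>r c. billiard_reflection (conic_tangent a b 0 (P s)) (P s - P u) r \<and> c > 0 \<and> P v - P s = c *\<^sub>R r)
    \<longleftrightarrow> chord_form a b s s \<noteq> 0 \<and> reflected_chords a b u s v"
proof -
  define c0 where "c0 = sqrt (a + b)"
  have c0: "c0 > 0" using ab by (simp add: c0_def)
  define \<rho> where "\<rho> x = 2 * (x - s) / (c0 * (s\<^sup>2 + 1) * (x\<^sup>2 + 1))" for x
  have \<rho>: "P x - P s = \<rho> x *\<^sub>R chord_dir a b s x" for x
    unfolding P_def \<rho>_def c0_def by (rule ellipse_point_diff[OF ab])
  have \<rho>u: "P s - P u = (- \<rho> u) *\<^sub>R chord_dir a b s u"
    using \<rho>[of u] by (metis minus_diff_eq scaleR_minus_left)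
  define e where "e x = 2 / (c0 * (s\<^sup>2 + 1) * (x\<^sup>2 + 1))" for x
  have e: "e x > 0" "\<rho> x = (x - s) * e x" for x
    using c0 square_add_1_pos(1) by (auto simp: e_def \<rho>_def)
  define h H where "h = chord_form a b s u" and "H = chord_form a b s s"
  define V where "V = (2 * h) *\<^sub>R chord_dir a b s s - H *\<^sub>R chord_dir a b s u"
  have refl: "billiard_reflection (conic_tangent a b 0 (P s)) (P s - P u) r \<longleftrightarrow>
    H \<noteq> 0 \<and> H *\<^sub>R r = (- \<rho> u) *\<^sub>R V" for r
    unfolding \<rho>u unfolding P_def V_def h_def H_def
    by (rule billiard_reflection_ellipse_point_iff[OF ab])
  have V: "V = k *\<^sub>R chord_dir a b s v \<longleftrightarrow> k = 2 * h - H \<and> 2 * h * s - H * u = k * v" for k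
    unfolding V_def h_def H_def by (rule reflected_chord_dir_iff[OF ab])
  have \<rho>0: "\<rho> u \<noteq> 0" "\<rho> v \<noteq> 0" using ne e[of u] e[of v] by auto
  show ?thesis
  proof
    assume "\<exists>r c. billiard_reflection (conic_tangent a b 0 (P s)) (P s - P u) r \<and> c > 0 \<and> P v - P s = c *\<^sub>R r"
    then obtain r c where rc: "H \<noteq> 0" "H *\<^sub>R r = (- \<rho> u) *\<^sub>R V" "c > 0" "\<rho> v *\<^sub>R chord_dir a b s v = c *\<^sub>R r"
      unfolding refl \<rho> by blast
    have "(c * (- \<rho> u)) *\<^sub>R V = c *\<^sub>R (H *\<^sub>R r)" unfolding rc(2) by simp
    also have "\<dots> = H *\<^sub>R (\<rho> v *\<^sub>R chord_dir a b s v)" unfolding rc(4) by (simp add: mult.commute)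
    finally have "(c * (- \<rho> u)) *\<^sub>R V = (H * \<rho> v) *\<^sub>R chord_dir a b s v" by simp
    moreover have cu: "c * (- \<rho> u) \<noteq> 0" using rc(3) \<rho>0 by simp
    ultimately have "V = (H * \<rho> v / (c * (- \<rho> u))) *\<^sub>R chord_dir a b s v"
      by (metis (no_types) eq_vector_fraction_iff)
    hence "2 * h * s - H * u = (2 * h - H) * v" unfolding V by metis
    thus "chord_form a b s s \<noteq> 0 \<and> reflected_chords a b u s v"
      using rc(1) by (simp add: reflected_chords_def h_def H_def algebra_simps)
  next
    assume "chord_form a b s s \<noteq> 0 \<and> reflected_chords a b u s v"
    hence H: "H \<noteq> 0" and r: "2 * h * (v - s) = H * (v - u)"
      by (auto simp: reflected_chords_def h_def H_def)
    have V_eq: "V = (2 * h - H) *\<^sub>R chord_dir a b s v"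
      unfolding V using r by (simp add: algebra_simps)
    define k where "k = - \<rho> u * (2 * h - H) / H"
    have pos: "- (2 * h - H) * (u - s) * (v - s) * H > 0"
      by (rule chord_form_self_nonzero_step[OF r H ne])
    have "k * \<rho> v = (- (2 * h - H) * (u - s) * (v - s) * H) * (e u * e v) / (H * H)"
      using H by (simp add: k_def e field_simps)
    also have "\<dots> > 0"
    proof (rule divide_pos_pos[OF mult_pos_pos[OF pos mult_pos_pos[OF e(1) e(1)]]])
      show "H * H > 0" using H by (auto simp: zero_less_mult_iff)
    qed
    finally have "k * \<rho> v > 0" .
    hence k: "\<rho> v / k > 0" "k \<noteq> 0" by (auto simp: zero_less_mult_iff zero_less_divide_iff)
    have "H *\<^sub>R (k *\<^sub>R chord_dir a b s v) = (- \<rho> u) *\<^sub>R V"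
      unfolding V_eq using H by (simp add: k_def)
    hence "billiard_reflection (conic_tangent a b 0 (P s)) (P s - P u) (k *\<^sub>R chord_dir a b s v)"
      unfolding refl using H by simp
    moreover have "P v - P s = (\<rho> v / k) *\<^sub>R (k *\<^sub>R chord_dir a b s v)"
      unfolding \<rho> using k by simp
    ultimately show "\<exists>r c. billiard_reflection (conic_tangent a b 0 (P s)) (P s - P u) r \<and> c > 0 \<and> P v - P s = c *\<^sub>R r"
      using k(1) by blast
  qed
qed

lemma trajectory_iff_poncelet_sequence:
  assumes ab: "a > 0" "b > 0" and \<gamma>: "\<gamma> \<notin> {- b, 0, a}"
  shows "billiard_trajectory a b (\<lambda>k. ellipse_point a b (s k)) \<and> has_caustic a b \<gamma> (\<lambda>k. ellipse_point a b (s k))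
    \<longleftrightarrow> poncelet_sequence a b \<gamma> s \<and> (\<forall>k. chord_form a b (s k) (s k) \<noteq> 0)"
proof
  have nd: "\<gamma> \<noteq> a" "\<gamma> \<noteq> - b" using \<gamma> by auto
  assume "billiard_trajectory a b (\<lambda>k. ellipse_point a b (s k)) \<and> has_caustic a b \<gamma> (\<lambda>k. ellipse_point a b (s k))"
  hence traj: "ellipse_point a b (s k) \<noteq> ellipse_point a b (s (k + 1))"
      "\<exists>r c. billiard_reflection (conic_tangent a b 0 (ellipse_point a b (s k)))
        (ellipse_point a b (s k) - ellipse_point a b (s (k - 1))) r \<and>
        c > 0 \<and> ellipse_point a b (s (k + 1)) - ellipse_point a b (s k) = c *\<^sub>R r"
    and tang: "tangent_to_conic a b \<gamma> (affine hull {ellipse_point a b (s k), ellipse_point a b (s (k + 1))})" for k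
    unfolding billiard_trajectory_def has_caustic_def by blast+
  have ne: "s k \<noteq> s (k + 1)" "s (k - 1) \<noteq> s k" "s (k + 1) \<noteq> s k" for k
    using traj(1)[of k] traj(1)[of "k - 1"] by auto
  have touch: "chord_touches a b \<gamma> (s k) (s (k + 1))" for k
    using tang tangent_chord_iff[OF ab nd ne(1)] by blast
  have touch': "chord_touches a b \<gamma> (s k) (s (k - 1))" for k
    using touch[of "k - 1"] chord_touches_commute[OF ab] by simp
  have refl: "chord_form a b (s k) (s k) \<noteq> 0" "reflected_chords a b (s (k - 1)) (s k) (s (k + 1))" for k
    using traj(2)[of k] reflection_step_iff[OF ab ne(2,3)] by blast+
  have s0: "s k \<noteq> 0" for k using refl(1)[of k] by (auto simp: chord_form_self)
  have "poncelet_step a b \<gamma> (s (k - 1)) (s k) (s (k + 1))" for k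
    by (rule poncelet_step_if_reflected_chords[OF ab s0 ne(2,3) touch' touch refl(2)])
  thus "poncelet_sequence a b \<gamma> s \<and> (\<forall>k. chord_form a b (s k) (s k) \<noteq> 0)"
    using s0 ne(1) refl(1) unfolding poncelet_sequence_def by blast
next
  have nd: "\<gamma> \<noteq> a" "\<gamma> \<noteq> - b" using \<gamma> by auto
  assume "poncelet_sequence a b \<gamma> s \<and> (\<forall>k. chord_form a b (s k) (s k) \<noteq> 0)"
  hence s: "s k \<noteq> 0" "s k \<noteq> s (k + 1)" "poncelet_step a b \<gamma> (s (k - 1)) (s k) (s (k + 1))"
    and form: "chord_form a b (s k) (s k) \<noteq> 0" for k
    unfolding poncelet_sequence_def by blast+
  have ne: "s (k - 1) \<noteq> s k" "s (k + 1) \<noteq> s k" for k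
    using s(2)[of k] s(2)[of "k - 1"] by auto
  have touch: "chord_touches a b \<gamma> (s k) (s (k + 1))" for k
    using s(3)[of "k + 1"] chord_touches_commute[OF ab] by (simp add: poncelet_step_def)
  have "has_caustic a b \<gamma> (\<lambda>k. ellipse_point a b (s k))"
    unfolding has_caustic_def using touch tangent_chord_iff[OF ab nd s(2)] by blast
  moreover have "billiard_trajectory a b (\<lambda>k. ellipse_point a b (s k))"
    unfolding billiard_trajectory_def
    using ellipse_point_in_ellipse[OF ab] ellipse_point_inj[OF ab] s(2) form
      reflection_step_iff[OF ab ne] reflected_chords_if_poncelet_step[OF ab s(1,3)] by blast
  ultimately show "billiard_trajectory a b (\<lambda>k. ellipse_point a b (s k)) \<and> has_caustic a b \<gamma> (\<lambda>k. ellipse_point a b (s k))"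
    by blast
qed

lemma trajectory_parametrization:
  assumes ab: "a > 0" "b > 0" and "billiard_trajectory a b p"
  obtains s where "p = (\<lambda>k. ellipse_point a b (s k))"
proof -
  have "\<exists>s. p k = ellipse_point a b s" for k
  proof -
    obtain x y where xy: "p k = (x, y)" by fastforce
    have on: "(x, y) \<in> ellipse a b" and "\<exists>r. billiard_reflection (conic_tangent a b 0 (x, y)) (p k - p (k - 1)) r"
      using assms(3) unfolding billiard_trajectory_def xy[symmetric] by blast+
    hence "minkowski (y / b, - (x / a)) (y / b, - (x / a)) \<noteq> 0"
      using billiard_reflection_iff[OF ab on] by blast
    hence "(y / b)\<^sup>2 \<noteq> (x / a)\<^sup>2" by (simp add: minkowski_def power2_eq_square)
    from ex_ellipse_point[OF ab on this] show ?thesis unfolding xy .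
  qed
  hence "\<exists>s. \<forall>k. p k = ellipse_point a b (s k)" by metis
  thus thesis using that by blast
qed

lemma all_trajectories_periodic_iff:
  assumes ab: "a > 0" "b > 0" and \<gamma>: "\<gamma> \<notin> {- b, 0, a}"
  shows "(\<forall>p. billiard_trajectory a b p \<and> has_caustic a b \<gamma> p \<longrightarrow> periodic_trajectory n p) \<longleftrightarrow>
    (\<forall>s. poncelet_sequence a b \<gamma> s \<and> (\<forall>k. chord_form a b (s k) (s k) \<noteq> 0) \<longrightarrow> (\<forall>k. s (k + int n) = s k))"
proof (intro iffI allI impI)
  fix s k
  assume "\<forall>p. billiard_trajectory a b p \<and> has_caustic a b \<gamma> p \<longrightarrow> periodic_trajectory n p"
    and "poncelet_sequence a b \<gamma> s \<and> (\<forall>k. chord_form a b (s k) (s k) \<noteq> 0)"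
  hence "periodic_trajectory n (\<lambda>k. ellipse_point a b (s k))"
    using trajectory_iff_poncelet_sequence[OF assms] by blast
  thus "s (k + int n) = s k"
    by (simp add: periodic_trajectory_def ellipse_point_inj[OF ab])
next
  fix p
  assume per: "\<forall>s. poncelet_sequence a b \<gamma> s \<and> (\<forall>k. chord_form a b (s k) (s k) \<noteq> 0) \<longrightarrow> (\<forall>k. s (k + int n) = s k)"
    and p: "billiard_trajectory a b p \<and> has_caustic a b \<gamma> p"
  obtain s where s: "p = (\<lambda>k. ellipse_point a b (s k))"
    using p trajectory_parametrization[OF ab] by blast
  have "\<forall>k. s (k + int n) = s k"
    using per p trajectory_iff_poncelet_sequence[OF assms] unfolding s by blast
  thus "periodic_trajectory n p" by (simp add: periodic_trajectory_def s)
qed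

section \<open>Existence of trajectories\<close>

text \<open>As long as the orbit avoids \<open>Bad\<close>, \<open>g\<close> retraces it. An orbit
  that enters \<open>Bad\<close> after \<open>n\<close> steps thus starts in the image of
  \<open>Bad\<close> under the \<open>n\<close>-th power of \<open>g\<close>.\<close>

lemma orbit_avoids_bad:
  assumes step: "\<And>z. z \<in> Z \<Longrightarrow> z \<notin> Bad \<Longrightarrow> f z \<in> Z \<and> g (f z) = z"
    and z: "z \<in> Z" "z \<notin> (\<Union>n. (g ^^ n) ` Bad)"
  shows "(f ^^ n) z \<in> Z \<and> (f ^^ n) z \<notin> Bad"
proof -
  have "(f ^^ n) z \<in> Z \<and> (f ^^ n) z \<notin> Bad \<and> (g ^^ n) ((f ^^ n) z) = z"
  proof (induction n)
    case 0
    have "z \<notin> (g ^^ 0) ` Bad" using z(2) by blast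
    thus ?case using z(1) by simp
  next
    case (Suc n)
    define w where "w = (f ^^ n) z"
    have w: "f w \<in> Z" "g (f w) = w" "(g ^^ n) w = z"
      using Suc.IH step[of w] by (auto simp: w_def)
    hence "(g ^^ Suc n) (f w) = z" by (simp add: funpow_swap1)
    moreover from this have "f w \<notin> Bad"
      using z(2) imageI[of "f w" Bad "g ^^ Suc n"] by blast
    ultimately show ?case using w(1) by (simp add: w_def)
  qed
  thus ?thesis by blast
qed

text \<open>
  Only countably many chords lead, forwards or backwards, to a point where the construction breaks
  down, while uncountably many chords touch the caustic.
\<close>

definition touching_pairs :: "real \<Rightarrow> real \<Rightarrow> real \<Rightarrow> (real \<times> real) set" where
  "touching_pairs a b \<gamma> = {(s, u). chord_touches a b \<gamma> s u}"

text \<open>Where \<open>polar_lead\<close> vanishes, the polar quadratic loses its degree: a root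
  moves to the omitted point at infinity.\<close>

definition singular_params :: "real \<Rightarrow> real \<Rightarrow> real \<Rightarrow> real set" where
  "singular_params a b \<gamma> = {s. chord_form a b s s = 0 \<or> polar_lead a b \<gamma> s = 0}"

text \<open>The second root, from the sum of the roots. In this form it is an involution in
  \<open>u\<close> even where the division by zero returns 0.\<close>

definition other_end :: "real \<Rightarrow> real \<Rightarrow> real \<Rightarrow> real \<Rightarrow> real \<Rightarrow> real" where
  "other_end a b \<gamma> s u = - polar_mid a b \<gamma> s / polar_lead a b \<gamma> s - u"

lemma finite_quadratic_roots:
  fixes A B C :: real
  assumes "A \<noteq> 0 \<or> B \<noteq> 0 \<or> C \<noteq> 0"
  shows "finite {x. A * x\<^sup>2 + B * x + C = 0}"
proof -
  have "[:C, B, A:] \<noteq> 0" using assms by auto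
  moreover have "{x. A * x\<^sup>2 + B * x + C = 0} = {x. poly [:C, B, A:] x = 0}"
    by (auto simp: algebra_simps power2_eq_square)
  ultimately show ?thesis using poly_roots_finite by metis
qed

lemma finite_singular_params:
  assumes "a > 0" "b > 0" "\<gamma> \<noteq> 0"
  shows "finite (singular_params a b \<gamma>)"
proof -
  define t where "t = sqrt (a * b)"
  have t: "t > 0" using assms by (simp add: t_def)
  have "singular_params a b \<gamma> \<subseteq> {0} \<union> {s. (- t) * s\<^sup>2 + (- (b - a)) * s + t = 0} \<union>
      {s. 0 * s\<^sup>2 + (- 2 * \<gamma> * t) * s + (a * b - \<gamma> * (b - a)) = 0}"
  proof
    fix s assume "s \<in> singular_params a b \<gamma>"
    hence "s = 0 \<or> t * (1 - s\<^sup>2) - (b - a) * s = 0 \<or> a * b - \<gamma> * (2 * t * s + (b - a)) = 0"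
      by (auto simp: singular_params_def chord_form_self polar_lead_def t_def)
    thus "s \<in> {0} \<union> {s. (- t) * s\<^sup>2 + (- (b - a)) * s + t = 0} \<union>
      {s. 0 * s\<^sup>2 + (- 2 * \<gamma> * t) * s + (a * b - \<gamma> * (b - a)) = 0}"
      by (auto simp: algebra_simps)
  qed
  moreover have "finite \<dots>"
    using t assms(3) by (intro finite_UnI finite_quadratic_roots) auto
  ultimately show ?thesis by (rule finite_subset)
qed

text \<open>By \<open>polar_eval_neg\<close> the polar quadratic can vanish identically only for
  \<open>s = 0\<close>, and there its middle coefficient is
  \<open>2 * \<gamma> * sqrt (a * b)\<close>.\<close>

lemma finite_touching:
  assumes "a > 0" "b > 0" "\<gamma> \<noteq> 0"
  shows "finite {u. chord_touches a b \<gamma> s u}"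
  unfolding chord_touches_def
proof (rule finite_quadratic_roots, rule ccontr)
  assume "\<not> (polar_lead a b \<gamma> s \<noteq> 0 \<or> polar_mid a b \<gamma> s \<noteq> 0 \<or> polar_const a b \<gamma> s \<noteq> 0)"
  hence 0: "polar_lead a b \<gamma> s = 0" "polar_mid a b \<gamma> s = 0" "polar_const a b \<gamma> s = 0" by auto
  hence "4 * (a * b) * s\<^sup>2 = 0" using polar_eval_neg[OF assms(1,2), of \<gamma> s] by simp
  hence "s = 0" using assms by simp
  thus False using 0(2) assms by (simp add: polar_mid_def)
qed

lemma touching_other_end:
  assumes "a > 0" "b > 0" "chord_touches a b \<gamma> s u" "polar_lead a b \<gamma> s \<noteq> 0"
  shows "chord_touches a b \<gamma> s (other_end a b \<gamma> s u)"
    and "poncelet_step a b \<gamma> u s (other_end a b \<gamma> s u)"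
proof -
  define A B C v where "A = polar_lead a b \<gamma> s" and "B = polar_mid a b \<gamma> s"
    and "C = polar_const a b \<gamma> s" and "v = other_end a b \<gamma> s u"
  have A: "A \<noteq> 0" and u: "A * u\<^sup>2 + B * u + C = 0"
    using assms by (auto simp: A_def B_def C_def chord_touches_def)
  have sum: "A * (u + v) = - B" using A by (simp add: v_def other_end_def A_def B_def)
  have "A * (u * v) - C = u * (A * (u + v)) - (A * u\<^sup>2 + C)"
    by (simp add: algebra_simps power2_eq_square)
  also have "\<dots> = 0" unfolding sum using u by (simp add: algebra_simps)
  finally have prod: "A * (u * v) = C" by simp
  have "A * v\<^sup>2 + B * v + C = v * (A * (u + v) + B) + (C - A * (u * v))"
    by (simp add: algebra_simps power2_eq_square)
  also have "\<dots> = 0" unfolding sum prod by simp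
  finally show "chord_touches a b \<gamma> s (other_end a b \<gamma> s u)"
    by (simp add: chord_touches_def A_def B_def C_def v_def)
  show "poncelet_step a b \<gamma> u s (other_end a b \<gamma> s u)"
    using sum prod assms(3) by (simp add: poncelet_step_def A_def B_def C_def v_def)
qed

lemma other_end_other_end: "other_end a b \<gamma> s (other_end a b \<gamma> s u) = u"
  by (simp add: other_end_def)

text \<open>Near \<open>s = 0\<close>, where the tangent of the ellipse is light-like, two real tangents to the caustic exist.\<close>

lemma uncountable_touching_pairs:
  assumes "a > 0" "b > 0" "\<gamma> \<noteq> 0"
  shows "uncountable (touching_pairs a b \<gamma>)"
proof
  assume "countable (touching_pairs a b \<gamma>)"
  hence countable: "countable (fst ` touching_pairs a b \<gamma>)" by simp
  define disc where "disc s = (polar_mid a b \<gamma> s)\<^sup>2 - 4 * polar_lead a b \<gamma> s * polar_const a b \<gamma> s" for s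
  \<comment> \<open>At \<open>s = 0\<close> the constant coefficient vanishes, so the discriminant
    is the square of the nonzero middle coefficient.\<close>
  have "disc 0 > 0" using assms by (simp add: disc_def polar_mid_def polar_const_def)
  moreover have "isCont disc 0"
    unfolding disc_def polar_mid_def polar_lead_def polar_const_def by (intro continuous_intros)
  ultimately have "eventually (\<lambda>s. disc s > 0) (at 0)"
    unfolding isCont_def by (rule order_tendstoD(1)[rotated])
  then obtain d where d: "d > 0" "\<And>s. s \<noteq> 0 \<Longrightarrow> dist s 0 < d \<Longrightarrow> disc s > 0"
    unfolding eventually_at by blast
  have "{0<..<d} - singular_params a b \<gamma> \<subseteq> fst ` touching_pairs a b \<gamma>"
  proof
    fix s assume s: "s \<in> {0<..<d} - singular_params a b \<gamma>"
    define A B C where "A = polar_lead a b \<gamma> s" and "B = polar_mid a b \<gamma> s" and "C = polar_const a b \<gamma> s"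
    have A: "A \<noteq> 0" using s by (simp add: A_def singular_params_def)
    define r where "r = sqrt (disc s)"
    have r: "r\<^sup>2 = B\<^sup>2 - 4 * A * C"
      using d(2)[of s] s by (simp add: r_def disc_def A_def B_def C_def less_imp_le)
    define u where "u = (r - B) / (2 * A)"
    have u: "2 * A * u + B = r" using A by (simp add: u_def)
    have "4 * A * (A * u\<^sup>2 + B * u + C) = (2 * A * u + B)\<^sup>2 - (B\<^sup>2 - 4 * A * C)"
      by (simp add: algebra_simps power2_eq_square)
    also have "\<dots> = 0" unfolding u r by simp
    finally have "chord_touches a b \<gamma> s u" using A by (simp add: chord_touches_def A_def B_def C_def)
    thus "s \<in> fst ` touching_pairs a b \<gamma>"
      by (intro image_eqI[of _ _ "(s, u)"]) (auto simp: touching_pairs_def)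
  qed
  hence "countable ({0<..<d} - singular_params a b \<gamma>)"
    using countable countable_subset by blast
  moreover have "uncountable ({0<..<d} - singular_params a b \<gamma>)"
    using d(1) finite_singular_params[OF assms]
    by (intro uncountable_minus_countable uncountable_open_interval[THEN iffD2] countable_finite)
  ultimately show False by blast
qed

lemma ex_poncelet_sequence:
  assumes ab: "a > 0" "b > 0" and "\<gamma> \<noteq> 0"
  obtains s where "poncelet_sequence a b \<gamma> s" "\<And>k. chord_form a b (s k) (s k) \<noteq> 0"
proof -
  define Z where "Z = touching_pairs a b \<gamma>"
  define N where "N = singular_params a b \<gamma>"
  define Bad where "Bad = {z \<in> Z. fst z \<in> N \<or> snd z \<in> N}"
  \<comment> \<open>A state is an oriented chord; \<open>f\<close> and \<open>g\<close> pass to the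
    next and the previous chord and undo each other outside \<open>Bad\<close>.\<close>
  define f where "f = (\<lambda>(s, u). (u, other_end a b \<gamma> u s))"
  define g where "g = (\<lambda>(s, u). (other_end a b \<gamma> s u, s))"
  note commute = chord_touches_commute[OF ab]
  have good: "chord_form a b s s \<noteq> 0" "polar_lead a b \<gamma> s \<noteq> 0" if "s \<notin> N" for s
    using that by (auto simp: N_def singular_params_def)
  have f: "f z \<in> Z \<and> g (f z) = z" if "z \<in> Z" "z \<notin> Bad" for z
    using that touching_other_end(1)[OF ab] good commute
    by (auto simp: Z_def touching_pairs_def Bad_def f_def g_def other_end_other_end)
  have g: "g z \<in> Z \<and> f (g z) = z" if "z \<in> Z" "z \<notin> Bad" for z
    using that touching_other_end(1)[OF ab] good commute
    by (auto simp: Z_def touching_pairs_def Bad_def f_def g_def other_end_other_end)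
  have "finite Bad"
  proof (rule finite_subset)
    show "Bad \<subseteq> (\<Union>s\<in>N. Pair s ` {u. chord_touches a b \<gamma> s u}) \<union> (\<Union>u\<in>N. (\<lambda>s. (s, u)) ` {s. chord_touches a b \<gamma> u s})"
      using commute by (auto simp: Bad_def Z_def touching_pairs_def)
    show "finite \<dots>"
      using finite_singular_params[OF assms] finite_touching[OF assms] by (auto simp: N_def)
  qed
  hence "countable ((\<Union>n. (g ^^ n) ` Bad) \<union> (\<Union>n. (f ^^ n) ` Bad))"
    using countable_finite by blast
  hence "\<not> Z \<subseteq> (\<Union>n. (g ^^ n) ` Bad) \<union> (\<Union>n. (f ^^ n) ` Bad)"
    using uncountable_touching_pairs[OF assms] countable_subset unfolding Z_def by blast
  then obtain z0 where z0: "z0 \<in> Z" "z0 \<notin> (\<Union>n. (g ^^ n) ` Bad)" "z0 \<notin> (\<Union>n. (f ^^ n) ` Bad)"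
    by blast
  define z where "z k = (if k \<ge> 0 then (f ^^ nat k) z0 else (g ^^ nat (- k)) z0)" for k :: int
  have z_good: "z k \<in> Z" "z k \<notin> Bad" for k
    using orbit_avoids_bad[of Z Bad f g z0, OF f z0(1,2)] orbit_avoids_bad[of Z Bad g f z0, OF g z0(1,3)]
    by (auto simp: z_def)
  have z_step: "z (k + 1) = f (z k)" for k
  proof (cases "k \<ge> 0")
    case True
    hence "nat (k + 1) = Suc (nat k)" by simp
    thus ?thesis using True by (simp add: z_def)
  next
    case False
    hence "nat (- k) = Suc (nat (- (k + 1)))" by simp
    hence "z k = g (z (k + 1))" using False by (auto simp: z_def)
    thus ?thesis using g[OF z_good] by simp
  qed
  define s where "s k = fst (z k)" for k
  have z_eq: "z k = (s k, s (k + 1))" for k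
    using z_step[of k] by (cases "z k") (simp add: s_def f_def)
  have touch: "chord_touches a b \<gamma> (s k) (s (k + 1))" for k
    using z_good(1)[of k] by (simp add: z_eq Z_def touching_pairs_def)
  have sN: "s k \<notin> N" for k
    using z_good[of k] by (simp add: z_eq Bad_def)
  have next_eq: "s (k + 1) = other_end a b \<gamma> (s k) (s (k - 1))" for k
    using z_step[of "k - 1"] by (simp add: z_eq f_def)
  have step: "poncelet_step a b \<gamma> (s (k - 1)) (s k) (s (k + 1))" for k
    unfolding next_eq using touch[of "k - 1"] commute good(2)[OF sN]
    by (intro touching_other_end(2)[OF ab]) auto
  \<comment> \<open>A chord with equal ends would be a tangent of the ellipse touching the caustic,
    and such common tangents are light-like.\<close>
  have "s k \<noteq> s (k + 1)" for k
  proof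
    assume "s k = s (k + 1)"
    hence "chord_touches a b \<gamma> (s k) (s k)" using touch[of k] by simp
    hence "\<gamma> * chord_form a b (s k) (s k) = 0"
      unfolding chord_touches_iff[OF ab] chord_form_self by (simp add: algebra_simps power2_eq_square)
    thus False using assms(3) good(1)[OF sN] by simp
  qed
  moreover have "s k \<noteq> 0" for k
    using good(1)[OF sN, of k] by (auto simp: chord_form_self)
  ultimately have "poncelet_sequence a b \<gamma> s"
    using step by (simp add: poncelet_sequence_def)
  thus thesis using that good(1)[OF sN] by blast
qed

section \<open>Passage to the given Taylor coefficients\<close>

lemma hankel_det_cmult:
  fixes c :: "nat \<Rightarrow> real"
  assumes "\<rho> \<noteq> 0"
  shows "hankel_det (\<lambda>i. \<rho> * c i) s m = 0 \<longleftrightarrow> hankel_det c s m = 0"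
proof -
  have "Matrix.mat m m (\<lambda>(i, j). \<rho> * c (Suc i + Suc j + s)) =
      \<rho> \<cdot>\<^sub>m Matrix.mat m m (\<lambda>(i, j). c (Suc i + Suc j + s))"
    by (intro eq_matI) auto
  thus ?thesis using assms by (simp add: hankel_det_def)
qed

theorem theorem3p3:
  fixes a b \<gamma> :: real and n :: nat
  assumes "a > 0" and "b > 0"
    and "\<gamma> \<notin> {- b, 0, a}"
    and "n \<ge> 3"
  shows "(\<forall>p. billiard_trajectory a b p \<and> has_caustic a b \<gamma> p \<longrightarrow> periodic_trajectory n p) \<longleftrightarrow>
         (\<forall>m. (n = 2 * m + 1 \<longrightarrow> hankel_det (C_coeff a b \<gamma>) 0 m = 0) \<and>
              (n = 2 * m \<longrightarrow> hankel_det (B_coeff a b \<gamma>) 1 (m - 1) = 0))"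
proof -
  note ab = assms(1,2)
  have \<gamma>0: "\<gamma> \<noteq> 0" using assms(3) by simp
  obtain W :: "real fps" and \<rho> :: real where \<rho>: "\<rho> \<noteq> 0"
    and W: "W * W * fps_of_poly [:\<gamma>, -1:] = fps_of_poly (Polynomial.smult \<gamma> ([:a, -1:] * [:b, 1:]))"
      "fps_nth W 0 = sqrt (a * b)"
    and C: "\<And>n. fps_nth W n = \<rho> * C_coeff a b \<gamma> n"
    and B: "\<And>n. fps_nth (W * fps_of_poly [:\<gamma>, -1:]) n = \<rho> * B_coeff a b \<gamma> n"
    by (rule ex_cubic_sqrt_fps[OF ab \<gamma>0]) (rule that; assumption)
  define \<theta> where "\<theta> = fps_of_poly (parity_factor [:\<gamma>, -1:] n) * W"
  have \<theta>: "fps_nth \<theta> = (if even n then (\<lambda>i. \<rho> * B_coeff a b \<gamma> i) else (\<lambda>i. \<rho> * C_coeff a b \<gamma> i))"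
    using B C by (auto simp: \<theta>_def parity_factor_def mult.commute[of _ W])
  obtain s where s: "poncelet_sequence a b \<gamma> s" "\<And>k. chord_form a b (s k) (s k) \<noteq> 0"
    by (rule ex_poncelet_sequence[OF ab \<gamma>0]) blast
  have periodic: "(\<forall>k. s' (k + int n) = s' k) \<longleftrightarrow> pade_vanishing n \<theta>" if "poncelet_sequence a b \<gamma> s'" for s'
    unfolding \<theta>_def by (rule poncelet_sequence_periodic_iff[OF ab assms(3,4) that W])
  \<comment> \<open>The sequence \<open>s\<close> provides the trajectory from whose periodicity
    \<open>pade_vanishing\<close> follows; the converse applies to every sequence.\<close>
  have "(\<forall>p. billiard_trajectory a b p \<and> has_caustic a b \<gamma> p \<longrightarrow> periodic_trajectory n p) \<longleftrightarrow>
      pade_vanishing n \<theta>"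
    unfolding all_trajectories_periodic_iff[OF assms(1-3)] using periodic s by blast
  also have "\<dots> \<longleftrightarrow> hankel_det (fps_nth \<theta>) (if even n then 1 else 0) ((n - 1) div 2) = 0"
    unfolding pade_vanishing_def hankel_det_eq_0_iff_pade[OF assms(4)] ..
  also have "\<dots> \<longleftrightarrow> (\<forall>m. (n = 2 * m + 1 \<longrightarrow> hankel_det (C_coeff a b \<gamma>) 0 m = 0) \<and>
              (n = 2 * m \<longrightarrow> hankel_det (B_coeff a b \<gamma>) 1 (m - 1) = 0))"
  proof (cases "even n")
    case True
    then obtain k where k: "n = 2 * k" by blast
    have "(n - 1) div 2 = k - 1" using k assms(4) by linarith
    hence "hankel_det (fps_nth \<theta>) (if even n then 1 else 0) ((n - 1) div 2) = 0 \<longleftrightarrow>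
        hankel_det (B_coeff a b \<gamma>) 1 (k - 1) = 0"
      using True hankel_det_cmult[OF \<rho>] by (simp add: \<theta>)
    moreover have "n = 2 * m + 1 \<longleftrightarrow> False" "n = 2 * m \<longleftrightarrow> m = k" for m
      using k by presburger+
    ultimately show ?thesis by simp
  next
    case False
    then obtain k where k: "n = 2 * k + 1" by (rule oddE)
    hence "hankel_det (fps_nth \<theta>) (if even n then 1 else 0) ((n - 1) div 2) = 0 \<longleftrightarrow>
        hankel_det (C_coeff a b \<gamma>) 0 k = 0"
      using False hankel_det_cmult[OF \<rho>] by (simp add: \<theta>)
    moreover have "n = 2 * m + 1 \<longleftrightarrow> m = k" "n = 2 * m \<longleftrightarrow> False" for m
      using k by presburger+
    ultimately show ?thesis by simp
  qed
  finally show ?thesis .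
qed

end
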